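(* There is a unique map $\Theta:\overline{\mathcal A}\times\overline{\mathcal G}\to\overline{\mathcal A}$ such that $$h_{\Theta(\overline A,\overline g)}([\gamma])=\overline g(\gamma(0))^{-1}\,h_{\overline A}([\gamma])\,\overline g(\gamma(1))\qquad\text{for all }\gamma\in\mathcal P_{\mathrm{gen}},\ \overline A\in\overline{\mathcal A},\ \overline g\in\overline{\mathcal G}.$$ $\Theta$ is continuous. Moreover, for each $\overline g\in\overline{\mathcal G}$, the map $\Theta_{\overline g}:=\Theta(\cdot,\overline g):\overline{\mathcal A}\to\overline{\mathcal A}$ is a homeomorphism and (for $\mathbf G$ compact) preserves the Ashtekar–Lewandowski measure $\mu_0$. The inverse of $\Theta_{\overline g}$ is $\Theta_{\overline g^{-1}}$.
   Context: Paths. Fix a manifold $M$, a connected Lie group $\mathbf G$, and $r$ a positive integer, $\infty$ or $\omega$. Fix also the choice whether all paths are required to be piecewise embedded or not. A path is a piecewise $C^r$ map $[0,1]\to M$ (piecewise embedded, if so chosen). A path is trivial iff its image is a single point. The inverse is $\gamma^{-1}(t):=\gamma(1-t)$. Paths $\gamma_1,\gamma_2$ are composable iff $\gamma_1(1)=\gamma_2(0)$; then $(\gamma_1\gamma_2)(t):=\gamma_1(2t)$ for $t\in[0,\frac12]$ and $\gamma_2(2t-1)$ for $t\in[\frac12,1]$. An edge is a path $e$ such that $e(t_1)=e(t_2)$ implies $|t_1-t_2|\in\{0,1\}$. Two paths $\gamma_1,\gamma_2$ coincide up to the parametrization iff $\gamma_1=\gamma_2\circ\phi$ for some orientation preserving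 piecewise $C^r$ diffeomorphism $\phi:[0,1]\to[0,1]$. A path is finite iff it equals, up to the parametrization, a finite product of edges and trivial paths; all paths are assumed finite. Two paths are equivalent iff there is a finite sequence of paths from one to the other in which any two subsequent paths coincide up to the parametrization or up to insertion or deletion of a retracing $\delta\delta^{-1}$ (e.g. $\gamma_1\gamma_2$ and $\gamma_1\delta\delta^{-1}\gamma_2$). $\mathcal P_{\mathrm{gen}}$ is the set of all paths, $\mathcal P$ the set of equivalence classes $[\gamma]$; $\mathcal P$ is a groupoid. Segments of a path are its restrictions to connected subintervals, affinely stretched to domain $[0,1]$. Generalized connections. A hyph $\upsilon$ is a finite collection $(\gamma_1,\dots,\gamma_n)$ of edges each having a free point: $\gamma_i$ has a point such that, for at least one direction, none of the segments of $\gamma_i$ starting in that point in this direction is (up to the parametrization) a full segment of some $\gamma_j$ with $j<i$. The number of its edges is $\#\upsilon$. Hyphs are directed by the ordering generated by decomposition of paths and inclusion. $\mathcal P_\upsilon$ is the subgroupoid of $\mathcal P$ freely generated by the classes of edges in $\upsilon$, and $\overline{\mathcal A}_\upsilon:=\mathrm{Hom}(\mathcal P_\upsilon,\mathbf G)\cong\mathbf G^{\#\upsilon}$ with the topology of $\mathbf G^{\#\upsilon}$. The space of generalized connections is $\overline{\mathcal A}:=\mathrm{Hom}(\mathcal P,\mathbf G)=\varprojlim_\upsilon\overline{\mathcal A}_\upsilon$ with the projective limit topology, and $\pi_\upsilon:\overline{\mathcal A}\to\mathbf G^{\#\upsilon}$ are the canonical (evaluation) maps. An element $\overline A\in\overline{\mathcal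 A}$ is also written $h_{\overline A}:\mathcal P\to\mathbf G$. For compact $\mathbf G$, the Ashtekar–Lewandowski measure $\mu_0$ is the unique regular Borel measure on $\overline{\mathcal A}$ such that $(\pi_\upsilon)_*\mu_0$ is the (normalized) Haar measure on $\mathbf G^{\#\upsilon}$ for every hyph $\upsilon$. Gauge transforms: $\overline{\mathcal G}:=\mathrm{Maps}(M,\mathbf G)\cong\mathbf G^M$ is the set of all maps $M\to\mathbf G$, with the product topology; $\overline g^{-1}$ is the pointwise inverse. *)

theory Defs
  imports "HOL-Analysis.Analysis" "HOL-Algebra.Product_Groups"
begin

section \<open>Regularity of maps between finite-dimensional spaces\<close>

text \<open>The admissible values are \<open>Ck k\<close> with \<open>k \<ge> 1\<close>, \<open>Cinf\<close> and \<open>Comega\<close>.\<close>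

datatype regularity = Ck nat | Cinf | Comega

text \<open>
  The next three notions are meant for maps on an open subset \<open>S\<close> of a finite-dimensional space.
  There, continuity of all directional derivatives up to order \<open>k\<close> is continuity of the
  Frechet derivatives. The class \<open>real_normed_vector\<close> is used instead of \<open>euclidean_space\<close>
  in order not to exclude dimension zero.
\<close>

primrec Ck_on ::
  "nat \<Rightarrow> ('a::real_normed_vector \<Rightarrow> 'b::real_normed_vector) \<Rightarrow> 'a set \<Rightarrow> bool" where
  "Ck_on 0 f S \<longleftrightarrow> continuous_on S f"
| "Ck_on (Suc k) f S \<longleftrightarrow>
     (\<forall>x\<in>S. f differentiable (at x)) \<and>
     (\<forall>v. Ck_on k (\<lambda>x. frechet_derivative f (at x) v) S)"

text \<open>
  Real analyticity: near every point \<open>a\<close> the map is the sum of a power series in the coordinates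
  of \<open>x - a\<close> with respect to some basis \<open>B\<close>; the multi-indices are the functions
  \<open>\<alpha> : B \<rightarrow> nat\<close>.
\<close>

definition real_analytic_on ::
  "('a::real_normed_vector \<Rightarrow> 'b::real_normed_vector) \<Rightarrow> 'a set \<Rightarrow> bool" where
  "real_analytic_on f S \<longleftrightarrow>
     (\<forall>a\<in>S. \<exists>B c \<epsilon>. finite B \<and> independent B \<and> span B = UNIV \<and> \<epsilon> > 0 \<and>
        (\<forall>x\<in>ball a \<epsilon>.
           ((\<lambda>\<alpha>. (\<Prod>b\<in>B. representation B (x - a) b ^ \<alpha> b) *\<^sub>R c \<alpha>) has_sum f x)
             (B \<rightarrow>\<^sub>E (UNIV :: nat set))))"

definition Cr_on ::
  "regularity \<Rightarrow> ('a::real_normed_vector \<Rightarrow> 'b::real_normed_vector) \<Rightarrow> 'a set \<Rightarrow> bool" where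
  "Cr_on r f S \<longleftrightarrow>
     (case r of Ck k \<Rightarrow> Ck_on k f S | Cinf \<Rightarrow> (\<forall>k. Ck_on k f S) | Comega \<Rightarrow> real_analytic_on f S)"

text \<open>On a closed interval, \<open>C\<^sup>r\<close> near \<open>t\<close> means: locally the restriction of a \<open>C\<^sup>r\<close> map
  defined on an open interval around \<open>t\<close>.\<close>

definition Cr_near ::
  "regularity \<Rightarrow> (real \<Rightarrow> 'b::real_normed_vector) \<Rightarrow> real set \<Rightarrow> real \<Rightarrow> bool" where
  "Cr_near r f I t \<longleftrightarrow>
     (\<exists>\<epsilon>>0. \<exists>g. Cr_on r g (ball t \<epsilon>) \<and> (\<forall>s \<in> I \<inter> ball t \<epsilon>. g s = f s))"


section \<open>Manifolds and Lie groups\<close>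

record ('p, 'e) mfd =
  mtop :: "'p topology"
  charts :: "('p set \<times> ('p \<Rightarrow> 'e)) set"

definition is_manifold :: "regularity \<Rightarrow> ('p, 'e::real_normed_vector) mfd \<Rightarrow> bool" where
  "is_manifold r M \<longleftrightarrow>
     (\<exists>B :: 'e set. finite B \<and> span B = UNIV) \<and>
     Hausdorff_space (mtop M) \<and> second_countable (mtop M) \<and>
     (\<Union>(U, \<phi>)\<in>charts M. U) = topspace (mtop M) \<and>
     (\<forall>(U, \<phi>)\<in>charts M. openin (mtop M) U \<and> open (\<phi> ` U) \<and>
        homeomorphic_map (subtopology (mtop M) U) (top_of_set (\<phi> ` U)) \<phi>) \<and>
     (\<forall>(U, \<phi>)\<in>charts M. \<forall>(V, \<psi>)\<in>charts M. Cr_on r (\<psi> \<circ> inv_into U \<phi>) (\<phi> ` (U \<inter> V)))"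

text \<open>The carrier and the group law come from \<open>G\<close>, the manifold structure from \<open>L\<close>.\<close>

definition lie_group :: "'g monoid \<Rightarrow> ('g, 'f::real_normed_vector) mfd \<Rightarrow> bool" where
  "lie_group G L \<longleftrightarrow>
     group G \<and> is_manifold Cinf L \<and> topspace (mtop L) = carrier G \<and>
     continuous_map (prod_topology (mtop L) (mtop L)) (mtop L) (\<lambda>(x, y). x \<otimes>\<^bsub>G\<^esub> y) \<and>
     continuous_map (mtop L) (mtop L) (\<lambda>x. inv\<^bsub>G\<^esub> x) \<and>
     (\<forall>(U, \<phi>)\<in>charts L. \<forall>(V, \<psi>)\<in>charts L. \<forall>(W, \<omega>)\<in>charts L.
        Cr_on Cinf (\<lambda>(u, v). \<omega> (inv_into U \<phi> u \<otimes>\<^bsub>G\<^esub> inv_into V \<psi> v))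
          {(\<phi> x, \<psi> y) |x y. x \<in> U \<and> y \<in> V \<and> x \<otimes>\<^bsub>G\<^esub> y \<in> W}) \<and>
     (\<forall>(U, \<phi>)\<in>charts L. \<forall>(W, \<omega>)\<in>charts L.
        Cr_on Cinf (\<lambda>u. \<omega> (inv\<^bsub>G\<^esub> (inv_into U \<phi> u))) (\<phi> ` {x \<in> U. inv\<^bsub>G\<^esub> x \<in> W}))"


section \<open>Paths\<close>

definition piecewise_on_unit :: "(real \<Rightarrow> real \<Rightarrow> bool) \<Rightarrow> bool" where
  "piecewise_on_unit Q \<longleftrightarrow>
     (\<exists>(n::nat) \<tau>. \<tau> 0 = 0 \<and> \<tau> n = 1 \<and> (\<forall>i<n. \<tau> i < \<tau> (Suc i) \<and> Q (\<tau> i) (\<tau> (Suc i))))"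

definition Cr_piece ::
  "regularity \<Rightarrow> ('m, 'e::real_normed_vector) mfd \<Rightarrow> (real \<Rightarrow> 'm) \<Rightarrow> real \<Rightarrow> real \<Rightarrow> bool" where
  "Cr_piece r M \<gamma> a b \<longleftrightarrow>
     (\<forall>t\<in>{a..b}. \<exists>(U, \<phi>)\<in>charts M. \<gamma> t \<in> U \<and> Cr_near r (\<phi> \<circ> \<gamma>) {a..b} t)"

definition embedded_piece ::
  "('m, 'e::real_normed_vector) mfd \<Rightarrow> (real \<Rightarrow> 'm) \<Rightarrow> real \<Rightarrow> real \<Rightarrow> bool" where
  "embedded_piece M \<gamma> a b \<longleftrightarrow>
     embedding_map (top_of_set {a..b}) (mtop M) \<gamma> \<and>
     (\<forall>t\<in>{a..b}. \<forall>(U, \<phi>)\<in>charts M. \<gamma> t \<in> U \<longrightarrow>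
        vector_derivative (\<phi> \<circ> \<gamma>) (at t within {a..b}) \<noteq> 0)"

text \<open>
  A map \<open>[0,1] \<rightarrow> M\<close> is an element of \<open>extensional {0..1}\<close>. The flag \<open>emb\<close> is the choice whether
  paths are required to be piecewise embedded; trivial paths, and hence constant pieces, are
  admitted in both cases, because products of edges and trivial paths have to be paths.
  Finiteness is imposed in \<open>Pgen\<close> below.
\<close>

definition pw_path ::
  "regularity \<Rightarrow> bool \<Rightarrow> ('m, 'e::real_normed_vector) mfd \<Rightarrow> (real \<Rightarrow> 'm) \<Rightarrow> bool" where
  "pw_path r emb M \<gamma> \<longleftrightarrow>
     \<gamma> \<in> extensional {0..1} \<and> pathin (mtop M) \<gamma> \<and>
     piecewise_on_unit (\<lambda>a b. Cr_piece r M \<gamma> a b \<and>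
       (emb \<longrightarrow> (\<exists>x. \<forall>t\<in>{a..b}. \<gamma> t = x) \<or> embedded_piece M \<gamma> a b))"

definition trivial_path :: "(real \<Rightarrow> 'm) \<Rightarrow> bool" where
  "trivial_path \<gamma> \<longleftrightarrow> (\<exists>x. \<gamma> ` {0..1} = {x})"

definition is_edge ::
  "regularity \<Rightarrow> bool \<Rightarrow> ('m, 'e::real_normed_vector) mfd \<Rightarrow> (real \<Rightarrow> 'm) \<Rightarrow> bool" where
  "is_edge r emb M e \<longleftrightarrow>
     pw_path r emb M e \<and>
     (\<forall>t1\<in>{0..1}. \<forall>t2\<in>{0..1}. e t1 = e t2 \<longrightarrow> \<bar>t1 - t2\<bar> \<in> {0, 1})"

definition pw_diffeo :: "regularity \<Rightarrow> (real \<Rightarrow> real) \<Rightarrow> bool" where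
  "pw_diffeo r \<phi> \<longleftrightarrow>
     bij_betw \<phi> {0..1} {0..1} \<and> strict_mono_on {0..1} \<phi> \<and>
     piecewise_on_unit (\<lambda>a b. \<forall>t\<in>{a..b}. Cr_near r \<phi> {a..b} t) \<and>
     piecewise_on_unit (\<lambda>a b. \<forall>t\<in>{a..b}. Cr_near r (inv_into {0..1} \<phi>) {a..b} t)"

definition coincide :: "regularity \<Rightarrow> (real \<Rightarrow> 'm) \<Rightarrow> (real \<Rightarrow> 'm) \<Rightarrow> bool" where
  "coincide r \<gamma>1 \<gamma>2 \<longleftrightarrow> (\<exists>\<phi>. pw_diffeo r \<phi> \<and> (\<forall>t\<in>{0..1}. \<gamma>1 t = \<gamma>2 (\<phi> t)))"

definition path_inv :: "(real \<Rightarrow> 'm) \<Rightarrow> real \<Rightarrow> 'm" where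
  "path_inv \<gamma> = (\<lambda>t\<in>{0..1}. \<gamma> (1 - t))"

text \<open>Only meaningful for composable paths, i.e. if \<open>\<gamma>1 1 = \<gamma>2 0\<close>.\<close>

definition path_prod :: "(real \<Rightarrow> 'm) \<Rightarrow> (real \<Rightarrow> 'm) \<Rightarrow> real \<Rightarrow> 'm" (infixr \<open>\<diamondop>\<close> 75) where
  "\<gamma>1 \<diamondop> \<gamma>2 = (\<lambda>t\<in>{0..1}. if t \<le> 1/2 then \<gamma>1 (2 * t) else \<gamma>2 (2 * t - 1))"

inductive_set finite_products ::
  "regularity \<Rightarrow> bool \<Rightarrow> ('m, 'e::real_normed_vector) mfd \<Rightarrow> (real \<Rightarrow> 'm) set"
  for r emb M where
  edge: "is_edge r emb M e \<Longrightarrow> e \<in> finite_products r emb M"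
| trivial: "pw_path r emb M c \<Longrightarrow> trivial_path c \<Longrightarrow> c \<in> finite_products r emb M"
| prod: "p \<in> finite_products r emb M \<Longrightarrow> q \<in> finite_products r emb M \<Longrightarrow>
     p 1 = q 0 \<Longrightarrow> p \<diamondop> q \<in> finite_products r emb M"

definition Pgen ::
  "regularity \<Rightarrow> bool \<Rightarrow> ('m, 'e::real_normed_vector) mfd \<Rightarrow> (real \<Rightarrow> 'm) set" where
  "Pgen r emb M = {\<gamma>. pw_path r emb M \<gamma> \<and> (\<exists>p\<in>finite_products r emb M. coincide r \<gamma> p)}"

text \<open>
  \<open>insert_retracing P \<gamma> \<gamma>'\<close>: \<open>\<gamma>'\<close> arises from \<open>\<gamma>\<close> by inserting a retracing \<open>\<delta>\<delta>\<^sup>-\<^sup>1\<close>, where the part of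
  \<open>\<gamma>\<close> before or after the retracing may be missing. Other bracketings coincide with these up to
  the parametrization.
\<close>

inductive insert_retracing :: "(real \<Rightarrow> 'm) set \<Rightarrow> (real \<Rightarrow> 'm) \<Rightarrow> (real \<Rightarrow> 'm) \<Rightarrow> bool" for P where
  inside: "\<gamma>1 \<in> P \<Longrightarrow> \<gamma>2 \<in> P \<Longrightarrow> \<delta> \<in> P \<Longrightarrow>
     \<gamma>1 1 = \<gamma>2 0 \<Longrightarrow> \<gamma>1 1 = \<delta> 0 \<Longrightarrow>
     insert_retracing P (\<gamma>1 \<diamondop> \<gamma>2) (\<gamma>1 \<diamondop> (\<delta> \<diamondop> path_inv \<delta>) \<diamondop> \<gamma>2)"
| at_start: "\<gamma> \<in> P \<Longrightarrow> \<delta> \<in> P \<Longrightarrow> \<delta> 0 = \<gamma> 0 \<Longrightarrow>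
     insert_retracing P \<gamma> ((\<delta> \<diamondop> path_inv \<delta>) \<diamondop> \<gamma>)"
| at_end: "\<gamma> \<in> P \<Longrightarrow> \<delta> \<in> P \<Longrightarrow> \<gamma> 1 = \<delta> 0 \<Longrightarrow>
     insert_retracing P \<gamma> (\<gamma> \<diamondop> (\<delta> \<diamondop> path_inv \<delta>))"

definition path_step ::
  "regularity \<Rightarrow> bool \<Rightarrow> ('m, 'e::real_normed_vector) mfd \<Rightarrow> ((real \<Rightarrow> 'm) \<times> (real \<Rightarrow> 'm)) set" where
  "path_step r emb M =
     {(\<gamma>, \<gamma>'). \<gamma> \<in> Pgen r emb M \<and> \<gamma>' \<in> Pgen r emb M \<and>
        (coincide r \<gamma> \<gamma>' \<or> insert_retracing (Pgen r emb M) \<gamma> \<gamma>' \<or>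
         insert_retracing (Pgen r emb M) \<gamma>' \<gamma>)}"

definition path_equiv ::
  "regularity \<Rightarrow> bool \<Rightarrow> ('m, 'e::real_normed_vector) mfd \<Rightarrow> ((real \<Rightarrow> 'm) \<times> (real \<Rightarrow> 'm)) set" where
  "path_equiv r emb M = (path_step r emb M)\<^sup>* \<inter> Pgen r emb M \<times> Pgen r emb M"

definition path_class ::
  "regularity \<Rightarrow> bool \<Rightarrow> ('m, 'e::real_normed_vector) mfd \<Rightarrow> (real \<Rightarrow> 'm) \<Rightarrow> (real \<Rightarrow> 'm) set" where
  "path_class r emb M \<gamma> = path_equiv r emb M `` {\<gamma>}"

definition path_groupoid ::
  "regularity \<Rightarrow> bool \<Rightarrow> ('m, 'e::real_normed_vector) mfd \<Rightarrow> (real \<Rightarrow> 'm) set set" where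
  "path_groupoid r emb M = Pgen r emb M // path_equiv r emb M"


section \<open>Hyphs\<close>

text \<open>For \<open>b < a\<close> this is the segment between \<open>b\<close> and \<open>a\<close> run through backwards.\<close>

definition segment :: "real \<Rightarrow> real \<Rightarrow> (real \<Rightarrow> 'm) \<Rightarrow> real \<Rightarrow> 'm" where
  "segment a b \<gamma> = (\<lambda>t\<in>{0..1}. \<gamma> (a + (b - a) * t))"

text \<open>
  A segment of a hyph edge that traverses a segment of an earlier edge in the opposite direction
  also counts as contained in it (otherwise \<open>(\<gamma>, \<gamma>\<^sup>-\<^sup>1)\<close> would be a hyph).
\<close>

definition segment_of :: "regularity \<Rightarrow> (real \<Rightarrow> 'm) \<Rightarrow> (real \<Rightarrow> 'm) set \<Rightarrow> bool" where
  "segment_of r \<sigma> E \<longleftrightarrow>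
     (\<exists>\<gamma>\<in>E. \<exists>a\<in>{0..1}. \<exists>b\<in>{0..1}. coincide r \<sigma> (segment a b \<gamma>))"

text \<open>The point is given by its parameter \<open>t\<close>; the two disjuncts are the two directions.\<close>

definition has_free_point :: "regularity \<Rightarrow> (real \<Rightarrow> 'm) \<Rightarrow> (real \<Rightarrow> 'm) set \<Rightarrow> bool" where
  "has_free_point r \<gamma> E \<longleftrightarrow>
     (\<exists>t\<in>{0..1}.
        (t < 1 \<and> (\<forall>u\<in>{t<..1}. \<not> segment_of r (segment t u \<gamma>) E)) \<or>
        (0 < t \<and> (\<forall>u\<in>{0..<t}. \<not> segment_of r (segment t u \<gamma>) E)))"

definition hyph ::
  "regularity \<Rightarrow> bool \<Rightarrow> ('m, 'e::real_normed_vector) mfd \<Rightarrow> (real \<Rightarrow> 'm) list \<Rightarrow> bool" where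
  "hyph r emb M \<upsilon> \<longleftrightarrow>
     (\<forall>i<length \<upsilon>. is_edge r emb M (\<upsilon> ! i) \<and> has_free_point r (\<upsilon> ! i) (set (take i \<upsilon>)))"


section \<open>Generalized connections and gauge transforms\<close>

text \<open>Homomorphisms from the groupoid of paths to \<open>G\<close>; the groupoid product is
  \<open>[\<gamma>1] [\<gamma>2] = [\<gamma>1 \<gamma>2]\<close> for composable paths.\<close>

definition connections ::
  "regularity \<Rightarrow> bool \<Rightarrow> ('m, 'e::real_normed_vector) mfd \<Rightarrow> 'g monoid \<Rightarrow> ((real \<Rightarrow> 'm) set \<Rightarrow> 'g) set"
  where
  "connections r emb M G =
     {h \<in> path_groupoid r emb M \<rightarrow>\<^sub>E carrier G.
        \<forall>\<gamma>1\<in>Pgen r emb M. \<forall>\<gamma>2\<in>Pgen r emb M. \<gamma>1 1 = \<gamma>2 0 \<longrightarrow>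
          h (path_class r emb M (\<gamma>1 \<diamondop> \<gamma>2)) =
          h (path_class r emb M \<gamma>1) \<otimes>\<^bsub>G\<^esub> h (path_class r emb M \<gamma>2)}"

text \<open>The power \<open>G\<^sup>n\<close> is realised on the functions \<open>{..<n} \<rightarrow>\<^sub>E carrier G\<close>.\<close>

definition hyph_proj ::
  "regularity \<Rightarrow> bool \<Rightarrow> ('m, 'e::real_normed_vector) mfd \<Rightarrow> (real \<Rightarrow> 'm) list \<Rightarrow>
   ((real \<Rightarrow> 'm) set \<Rightarrow> 'g) \<Rightarrow> nat \<Rightarrow> 'g" where
  "hyph_proj r emb M \<upsilon> A = (\<lambda>i\<in>{..<length \<upsilon>}. A (path_class r emb M (\<upsilon> ! i)))"

definition power_topology :: "('g, 'f) mfd \<Rightarrow> nat \<Rightarrow> (nat \<Rightarrow> 'g) topology" where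
  "power_topology L n = product_topology (\<lambda>_. mtop L) {..<n}"

text \<open>The projective limit topology, i.e. the coarsest topology on the set of connections for which
  \<open>hyph_proj r emb M \<upsilon>\<close> is continuous for every hyph \<open>\<upsilon>\<close>.\<close>

definition connection_topology ::
  "regularity \<Rightarrow> bool \<Rightarrow> ('m, 'e::real_normed_vector) mfd \<Rightarrow> 'g monoid \<Rightarrow>
   ('g, 'f::real_normed_vector) mfd \<Rightarrow> ((real \<Rightarrow> 'm) set \<Rightarrow> 'g) topology" where
  "connection_topology r emb M G L =
     topology_generated_by
       {{A \<in> connections r emb M G. hyph_proj r emb M \<upsilon> A \<in> W} |\<upsilon> W.
          hyph r emb M \<upsilon> \<and> openin (power_topology L (length \<upsilon>)) W}"

definition gauge_topology :: "('m, 'e) mfd \<Rightarrow> ('g, 'f) mfd \<Rightarrow> ('m \<Rightarrow> 'g) topology" where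
  "gauge_topology M L = product_topology (\<lambda>_. mtop L) (topspace (mtop M))"

definition gauge_transforms :: "('m, 'e) mfd \<Rightarrow> 'g monoid \<Rightarrow> ('m \<Rightarrow> 'g) set" where
  "gauge_transforms M G = topspace (mtop M) \<rightarrow>\<^sub>E carrier G"

definition gauge_inverse :: "('m, 'e) mfd \<Rightarrow> 'g monoid \<Rightarrow> ('m \<Rightarrow> 'g) \<Rightarrow> 'm \<Rightarrow> 'g" where
  "gauge_inverse M G g = (\<lambda>x\<in>topspace (mtop M). inv\<^bsub>G\<^esub> (g x))"

text \<open>The maps \<open>\<Theta>\<close> from pairs of a connection and a gauge transform to connections that satisfy the
  transformation law; they are taken extensional, so that the domain is exactly the set of pairs.\<close>

definition is_gauge_action ::
  "regularity \<Rightarrow> bool \<Rightarrow> ('m, 'e::real_normed_vector) mfd \<Rightarrow> 'g monoid \<Rightarrow>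
   (((real \<Rightarrow> 'm) set \<Rightarrow> 'g) \<times> ('m \<Rightarrow> 'g) \<Rightarrow> (real \<Rightarrow> 'm) set \<Rightarrow> 'g) \<Rightarrow> bool" where
  "is_gauge_action r emb M G \<Theta> \<longleftrightarrow>
     \<Theta> \<in> connections r emb M G \<times> gauge_transforms M G \<rightarrow>\<^sub>E connections r emb M G \<and>
     (\<forall>\<gamma>\<in>Pgen r emb M. \<forall>A\<in>connections r emb M G. \<forall>g\<in>gauge_transforms M G.
        \<Theta> (A, g) (path_class r emb M \<gamma>) =
        inv\<^bsub>G\<^esub> (g (\<gamma> 0)) \<otimes>\<^bsub>G\<^esub> A (path_class r emb M \<gamma>) \<otimes>\<^bsub>G\<^esub> g (\<gamma> 1))"


section \<open>The Ashtekar--Lewandowski measure\<close>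

definition borel_of :: "'a topology \<Rightarrow> 'a measure" where
  "borel_of X = sigma (topspace X) {U. openin X U}"

definition regular_borel :: "'a topology \<Rightarrow> 'a measure \<Rightarrow> bool" where
  "regular_borel X \<mu> \<longleftrightarrow>
     sets \<mu> = sets (borel_of X) \<and>
     (\<forall>S\<in>sets \<mu>.
        emeasure \<mu> S = (INF U\<in>{U. openin X U \<and> S \<subseteq> U}. emeasure \<mu> U) \<and>
        emeasure \<mu> S = (SUP K\<in>{K. compactin X K \<and> K \<subseteq> S}. emeasure \<mu> K))"

definition normalized_haar :: "'a monoid \<Rightarrow> 'a topology \<Rightarrow> 'a measure \<Rightarrow> bool" where
  "normalized_haar K X \<mu> \<longleftrightarrow>
     regular_borel X \<mu> \<and> emeasure \<mu> (space \<mu>) = 1 \<and>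
     (\<forall>a\<in>carrier K. \<forall>S\<in>sets \<mu>. emeasure \<mu> ((\<lambda>x. a \<otimes>\<^bsub>K\<^esub> x) ` S) = emeasure \<mu> S)"

definition haar_marginals ::
  "regularity \<Rightarrow> bool \<Rightarrow> ('m, 'e::real_normed_vector) mfd \<Rightarrow> 'g monoid \<Rightarrow>
   ('g, 'f::real_normed_vector) mfd \<Rightarrow> ((real \<Rightarrow> 'm) set \<Rightarrow> 'g) measure \<Rightarrow> bool" where
  "haar_marginals r emb M G L \<mu> \<longleftrightarrow>
     (\<forall>\<upsilon>. hyph r emb M \<upsilon> \<longrightarrow>
        normalized_haar (product_group {..<length \<upsilon>} (\<lambda>_. G)) (power_topology L (length \<upsilon>))
          (distr \<mu> (borel_of (power_topology L (length \<upsilon>))) (hyph_proj r emb M \<upsilon>)))"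

text \<open>\<open>\<mu>\<close> is the unique regular Borel measure with these marginals.\<close>

definition ashtekar_lewandowski ::
  "regularity \<Rightarrow> bool \<Rightarrow> ('m, 'e::real_normed_vector) mfd \<Rightarrow> 'g monoid \<Rightarrow>
   ('g, 'f::real_normed_vector) mfd \<Rightarrow> ((real \<Rightarrow> 'm) set \<Rightarrow> 'g) measure \<Rightarrow> bool" where
  "ashtekar_lewandowski r emb M G L \<mu> \<longleftrightarrow>
     (\<forall>\<nu>. regular_borel (connection_topology r emb M G L) \<nu> \<and> haar_marginals r emb M G L \<nu>
        \<longleftrightarrow> \<nu> = \<mu>)"

end

theory Submission
  imports Defs
begin

text \<open>
  Equivalent paths have the same endpoints, so the transformation law determines
  \<open>\<Theta> (A, g)\<close> on every class of paths; it is again a homomorphism because the factors at the junction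
  of two paths cancel. This presupposes that the product of two paths is a path, which rests on the
  invariance of piecewise \<open>C\<^sup>r\<close> maps under affine substitutions. Seen through a hyph, \<open>\<Theta>\<close> acts on
  \<open>G\<^sup>n\<close> by a simultaneous left and right translation depending continuously on \<open>g\<close>; hence \<open>\<Theta>\<close> is
  continuous, and the image of \<open>\<mu>\<^sub>0\<close> under \<open>\<Theta>\<^sub>g\<close> is a regular measure with Haar marginals, i.e. \<open>\<mu>\<^sub>0\<close>
  by uniqueness.
\<close>

section \<open>Regularity under affine substitutions\<close>

text \<open>The homomorphism law for the transformed connection concerns
  \<open>p \<diamondop> q\<close>, and the transformation law gives a value there only if
  \<open>p \<diamondop> q\<close> is itself a path. Piecewise regularity of the product requires
  substitutions of slope 2; finiteness requires a parametrization glued from two halves, whose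
  values are halved as well. Hence the regularity lemmas treat m f(k x + c) + d, with affine maps on
  both sides, in the C^k and in the analytic case. Since the inverse of a parametrization must be
  piecewise regular too, the gluing has to be compatible with inversion. On the measure side no
  integral is computed: homeomorphisms carry regularity over, and an identity between projections
  and translations carries the marginals over.\<close>

lemma Ck_on_cong:
  assumes "open S" and "\<And>x. x \<in> S \<Longrightarrow> f x = g x" and "Ck_on n f S"
  shows "Ck_on n g S"
  using assms(2,3)
proof (induction n arbitrary: f g)
  case 0
  then show ?case by (simp cong: continuous_on_cong)
next
  case (Suc n)
  have diff: "f differentiable (at x)" if "x \<in> S" for x
    using Suc.prems(2) that by simp
  have "g differentiable (at x)" if "x \<in> S" for x
    using diff[OF that] Suc.prems(1) that assms(1) unfolding differentiable_def
    by (meson has_derivative_transform_within_open)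
  \<comment> \<open>On the open set S both functions agree near each point, so their derivatives
    agree on S in every direction; the induction varies f and g in order to continue with
    these.\<close>
  moreover have "Ck_on n (\<lambda>x. frechet_derivative g (at x) v) S" for v
  proof (rule Suc.IH)
    show "Ck_on n (\<lambda>x. frechet_derivative f (at x) v) S"
      using Suc.prems(2) by simp
    show "frechet_derivative f (at x) v = frechet_derivative g (at x) v" if "x \<in> S" for x
      using frechet_derivative_transform_within_open[OF diff[OF that] assms(1) that Suc.prems(1)]
      by simp
  qed
  ultimately show ?case by simp
qed

text \<open>Differentiation replaces f by its derivative in direction k v and kills the shift. The
  induction therefore varies f and d, and its hypothesis is used with d = 0.\<close>

lemma Ck_on_affine:
  fixes f :: "'a::real_normed_vector \<Rightarrow> 'b::real_normed_vector"
  assumes "open S" and "Ck_on n f S"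
  shows "Ck_on n (\<lambda>x. m *\<^sub>R f (k *\<^sub>R x + c) + d) ((\<lambda>x. k *\<^sub>R x + c) -` S)"
  using assms(2)
proof (induction n arbitrary: f d)
  case 0
  then have "continuous_on S f" by simp
  then have "continuous_on ((\<lambda>x. k *\<^sub>R x + c) -` S) (\<lambda>x. f (k *\<^sub>R x + c))"
    by (rule continuous_on_compose2) (auto intro!: continuous_intros)
  then show ?case by (auto intro!: continuous_intros)
next
  case (Suc n)
  let ?T = "(\<lambda>x. k *\<^sub>R x + c) -` S"
  have openT: "open ?T"
    using assms(1) by (intro open_vimage continuous_intros) auto
  have der: "((\<lambda>x. m *\<^sub>R f (k *\<^sub>R x + c) + d) has_derivative
      (\<lambda>v. m *\<^sub>R frechet_derivative f (at (k *\<^sub>R x + c)) (k *\<^sub>R v))) (at x)"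
    if "x \<in> ?T" for x
  proof -
    have "(f has_derivative frechet_derivative f (at (k *\<^sub>R x + c))) (at (k *\<^sub>R x + c))"
      using Suc.prems that by (simp add: frechet_derivative_works[symmetric])
    moreover have "((\<lambda>x. k *\<^sub>R x + c) has_derivative (\<lambda>v. k *\<^sub>R v)) (at x)"
      by (auto intro!: derivative_eq_intros)
    ultimately have "((\<lambda>x. f (k *\<^sub>R x + c)) has_derivative
        (\<lambda>v. frechet_derivative f (at (k *\<^sub>R x + c)) (k *\<^sub>R v))) (at x)"
      using diff_chain_at[of "\<lambda>x. k *\<^sub>R x + c" _ x f] by (auto simp: o_def)
    then show ?thesis by (auto intro!: derivative_eq_intros)
  qed
  have "Ck_on n (\<lambda>x. frechet_derivative (\<lambda>x. m *\<^sub>R f (k *\<^sub>R x + c) + d) (at x) v) ?T" for v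
  proof (rule Ck_on_cong[OF openT])
    show "Ck_on n (\<lambda>x. m *\<^sub>R frechet_derivative f (at (k *\<^sub>R x + c)) (k *\<^sub>R v) + 0) ?T"
      using Suc.prems by (intro Suc.IH[of "\<lambda>y. frechet_derivative f (at y) (k *\<^sub>R v)"]) simp
    show "m *\<^sub>R frechet_derivative f (at (k *\<^sub>R x + c)) (k *\<^sub>R v) + 0
        = frechet_derivative (\<lambda>x. m *\<^sub>R f (k *\<^sub>R x + c) + d) (at x) v" if "x \<in> ?T" for x
      using frechet_derivative_at[OF der[OF that]] by (auto dest: fun_cong)
  qed
  then show ?case
    using der by (auto simp: differentiable_def)
qed

text \<open>Substituting k x + c multiplies the coordinates of x - a by k. Over the same basis, each
  monomial picks up a power of k for every basis vector, and the radius \<epsilon> becomes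
  \<epsilon> / k.\<close>

lemma real_analytic_on_affine:
  fixes f :: "'a::real_normed_vector \<Rightarrow> 'b::real_normed_vector"
  assumes "real_analytic_on f S" and "k > 0"
  shows "real_analytic_on (\<lambda>x. m *\<^sub>R f (k *\<^sub>R x + c) + d) ((\<lambda>x. k *\<^sub>R x + c) -` S)"
  unfolding real_analytic_on_def
proof
  fix a assume "a \<in> (\<lambda>x. k *\<^sub>R x + c) -` S"
  then have "k *\<^sub>R a + c \<in> S" by simp
  from assms(1)[unfolded real_analytic_on_def, rule_format, OF this] obtain B C \<epsilon> where B: "finite B" "independent B" "span B = UNIV" and "\<epsilon> > 0"
    and sum: "\<And>y. y \<in> ball (k *\<^sub>R a + c) \<epsilon> \<Longrightarrow>
      ((\<lambda>\<alpha>. (\<Prod>b\<in>B. representation B (y - (k *\<^sub>R a + c)) b ^ \<alpha> b) *\<^sub>R C \<alpha>) has_sum f y)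
        (B \<rightarrow>\<^sub>E (UNIV :: nat set))"
    by (elim exE conjE) (rule that, assumption+, drule bspec)
  \<comment> \<open>The shift d goes into the constant term, whose multi-index is
    \<open>\<lambda>b\<in>B. 0\<close> because multi-indices are extensional on B.\<close>
  define C' where "C' = (\<lambda>\<alpha>. m *\<^sub>R (\<Prod>b\<in>B. k ^ \<alpha> b) *\<^sub>R C \<alpha> + (if \<alpha> = (\<lambda>b\<in>B. 0) then d else 0))"
  have "((\<lambda>\<alpha>. (\<Prod>b\<in>B. representation B (x - a) b ^ \<alpha> b) *\<^sub>R C' \<alpha>) has_sum
      m *\<^sub>R f (k *\<^sub>R x + c) + d) (B \<rightarrow>\<^sub>E (UNIV :: nat set))"
    if "x \<in> ball a (\<epsilon> / k)" for x
  proof -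
    let ?P = "\<lambda>\<alpha>. \<Prod>b\<in>B. representation B (x - a) b ^ \<alpha> b"
    have "dist (k *\<^sub>R a + c) (k *\<^sub>R x + c) = k * dist a x"
      using \<open>k > 0\<close> by (simp add: dist_norm flip: scaleR_diff_right)
    then have "k *\<^sub>R x + c \<in> ball (k *\<^sub>R a + c) \<epsilon>"
      using that \<open>k > 0\<close> by (simp add: field_simps)
    from has_sum_scaleR[OF sum[OF this], of m]
    have "((\<lambda>\<alpha>. m *\<^sub>R (\<Prod>b\<in>B. representation B (k *\<^sub>R (x - a)) b ^ \<alpha> b) *\<^sub>R C \<alpha>) has_sum
        m *\<^sub>R f (k *\<^sub>R x + c)) (B \<rightarrow>\<^sub>E (UNIV :: nat set))"
      by (simp add: scaleR_diff_right)
    moreover have "((\<lambda>\<alpha>. ?P \<alpha> *\<^sub>R (if \<alpha> = (\<lambda>b\<in>B. 0) then d else 0)) has_sum d)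
        (B \<rightarrow>\<^sub>E (UNIV :: nat set))"
      by (rule has_sum_finite_neutralI[of "{\<lambda>b\<in>B. 0}"]) auto
    ultimately have "((\<lambda>\<alpha>. m *\<^sub>R (\<Prod>b\<in>B. representation B (k *\<^sub>R (x - a)) b ^ \<alpha> b) *\<^sub>R C \<alpha>
        + ?P \<alpha> *\<^sub>R (if \<alpha> = (\<lambda>b\<in>B. 0) then d else 0)) has_sum
        m *\<^sub>R f (k *\<^sub>R x + c) + d) (B \<rightarrow>\<^sub>E (UNIV :: nat set))"
      by (rule has_sum_add)
    moreover have "m *\<^sub>R (\<Prod>b\<in>B. representation B (k *\<^sub>R (x - a)) b ^ \<alpha> b) *\<^sub>R C \<alpha>
        + ?P \<alpha> *\<^sub>R (if \<alpha> = (\<lambda>b\<in>B. 0) then d else 0) = ?P \<alpha> *\<^sub>R C' \<alpha>" for \<alpha>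
      using B by (simp add: C'_def representation_scale power_mult_distrib prod.distrib
          scaleR_add_right mult.commute mult.left_commute)
    ultimately show ?thesis by simp
  qed
  then show "\<exists>B C \<epsilon>. finite B \<and> independent B \<and> span B = UNIV \<and> \<epsilon> > 0 \<and>
        (\<forall>x\<in>ball a \<epsilon>. ((\<lambda>\<alpha>. (\<Prod>b\<in>B. representation B (x - a) b ^ \<alpha> b) *\<^sub>R C \<alpha>)
           has_sum m *\<^sub>R f (k *\<^sub>R x + c) + d) (B \<rightarrow>\<^sub>E (UNIV :: nat set)))"
    using B \<open>\<epsilon> > 0\<close> \<open>k > 0\<close>
    by (intro exI[of _ B] exI[of _ C'] exI[of _ "\<epsilon> / k"]) auto
qed

lemma Cr_on_affine:
  fixes f :: "'a::real_normed_vector \<Rightarrow> 'b::real_normed_vector"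
  assumes "open S" and "Cr_on r f S" and "k > 0"
  shows "Cr_on r (\<lambda>x. m *\<^sub>R f (k *\<^sub>R x + c) + d) ((\<lambda>x. k *\<^sub>R x + c) -` S)"
  using assms Ck_on_affine real_analytic_on_affine
  by (cases r) (fastforce simp: Cr_on_def)+

text \<open>The affine formula for \<open>f'\<close> is required on \<open>J\<close> only, which
  covers restrictions to smaller intervals and functions known only on [0,1]. With k = m = 1 and c =
  d = 0 it is a congruence rule.\<close>

lemma Cr_near_affine:
  assumes "Cr_near r f I (k * s + c)" and "k > 0"
    and "\<And>x. x \<in> J \<Longrightarrow> k * x + c \<in> I \<and> f' x = m *\<^sub>R f (k * x + c) + d"
  shows "Cr_near r f' J s"
proof -
  obtain \<epsilon> g where "\<epsilon> > 0" and g: "Cr_on r g (ball (k * s + c) \<epsilon>)"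
    and eq: "\<And>x. x \<in> I \<inter> ball (k * s + c) \<epsilon> \<Longrightarrow> g x = f x"
    using assms(1) unfolding Cr_near_def by blast
  have ball: "(\<lambda>x. k * x + c) -` ball (k * s + c) \<epsilon> = ball s (\<epsilon> / k)"
  proof -
    have "dist (k * s + c) (k * x + c) = k * dist s x" for x
      using \<open>k > 0\<close> by (simp add: dist_real_def abs_mult flip: right_diff_distrib)
    then show ?thesis using \<open>k > 0\<close> by (auto simp: field_simps)
  qed
  have "Cr_on r (\<lambda>x. m *\<^sub>R g (k *\<^sub>R x + c) + d) (ball s (\<epsilon> / k))"
    using Cr_on_affine[OF open_ball g \<open>k > 0\<close>, of m c d] by (simp add: ball)
  moreover have "m *\<^sub>R g (k *\<^sub>R x + c) + d = f' x" if "x \<in> J \<inter> ball s (\<epsilon> / k)" for x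
    using assms(3)[of x] eq[of "k * x + c"] that by (auto simp flip: ball)
  ultimately show ?thesis
    unfolding Cr_near_def using \<open>\<epsilon> > 0\<close> \<open>k > 0\<close>
    by (intro exI[of _ "\<epsilon> / k"] conjI exI[of _ "\<lambda>x. m *\<^sub>R g (k *\<^sub>R x + c) + d"]) auto
qed

section \<open>Regularity of the identity map\<close>

lemma Ck_on_const: "Ck_on n (\<lambda>x. c) S"
proof (induction n arbitrary: c)
  case (Suc n)
  have "frechet_derivative (\<lambda>x::'a. c) (at x) = (\<lambda>v. 0)" for x
    by (metis frechet_derivative_at has_derivative_const)
  with Suc show ?case by simp
qed simp

lemma Ck_on_ident: "Ck_on n (\<lambda>x. x) S"
proof (cases n)
  case (Suc n')
  have "frechet_derivative (\<lambda>x::'a. x) (at x) = (\<lambda>v. v)" for x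
    by (metis frechet_derivative_at has_derivative_ident)
  with Suc show ?thesis by (simp add: Ck_on_const)
qed simp

lemma real_analytic_on_ident: "real_analytic_on (\<lambda>x::real. x) S"
  unfolding real_analytic_on_def
proof
  fix a :: real
  let ?B = "{1::real}"
  let ?\<alpha> = "\<lambda>n. \<lambda>b\<in>?B. n :: nat"
  \<comment> \<open>The expansion is x = a + 1 (x - a): coefficient a in degree 0 and coefficient 1
    in degree 1.\<close>
  define C where "C = (\<lambda>\<alpha>. if \<alpha> = ?\<alpha> 0 then a else if \<alpha> = ?\<alpha> 1 then 1 else 0)"
  have span: "span ?B = UNIV"
    by (simp add: span_breakdown_eq set_eq_iff)
  have ind: "independent ?B" by simp
  have rep: "representation ?B y 1 = y" for y
    using representation_scale[OF ind, of 1 y] by (simp add: span representation_basis[OF ind])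
  have "?\<alpha> 0 \<noteq> ?\<alpha> 1"
    by (auto dest: fun_cong[of _ _ 1])
  then have "((\<lambda>\<alpha>. (\<Prod>b\<in>?B. representation ?B (x - a) b ^ \<alpha> b) *\<^sub>R C \<alpha>) has_sum x)
      (?B \<rightarrow>\<^sub>E (UNIV :: nat set))" for x
    by (intro has_sum_finite_neutralI[of "{?\<alpha> 0, ?\<alpha> 1}"]) (auto simp: C_def rep)
  then show "\<exists>B c \<epsilon>. finite B \<and> independent B \<and> span B = UNIV \<and> \<epsilon> > 0 \<and>
      (\<forall>x\<in>ball a \<epsilon>. ((\<lambda>\<alpha>. (\<Prod>b\<in>B. representation B (x - a) b ^ \<alpha> b) *\<^sub>R c \<alpha>) has_sum x)
         (B \<rightarrow>\<^sub>E (UNIV :: nat set)))"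
    using ind span by (intro exI[of _ ?B] exI[of _ C] exI[of _ 1]) auto
qed

text \<open>Leads to reflexivity of \<open>coincide\<close>, which puts edges among the paths in
  \<open>Pgen\<close>.\<close>

lemma Cr_near_ident: "Cr_near r (\<lambda>x. x) I t"
  unfolding Cr_near_def
  by (intro exI[of _ 1] conjI exI[of _ "\<lambda>x. x"])
    (auto simp: Cr_on_def Ck_on_ident real_analytic_on_ident split: regularity.split)

section \<open>Products of paths\<close>

lemma path_prod_at_0 [simp]: "(p \<diamondop> q) 0 = p 0"
  and path_prod_at_1 [simp]: "(p \<diamondop> q) 1 = q 1"
  by (simp_all add: path_prod_def)

lemma path_prod_left: "t \<in> {0..1/2} \<Longrightarrow> (p \<diamondop> q) t = p (2 * t)"
  by (simp add: path_prod_def)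

text \<open>The definition uses p at t = 1/2; composability makes the formula for q valid there as
  well. The pieces are closed intervals, so this point cannot be left out.\<close>

lemma path_prod_right:
  assumes "p 1 = q 0" and "t \<in> {1/2..1}"
  shows "(p \<diamondop> q) t = q (2 * t - 1)"
proof (cases "t = 1/2")
  case True
  then have "2 * t = 1" by simp
  with True assms show ?thesis by (simp add: path_prod_def del: eq_divide_eq_numeral1)
qed (use assms in \<open>auto simp: path_prod_def\<close>)

lemma path_inv_ends [simp]: "path_inv \<gamma> 0 = \<gamma> 1" "path_inv \<gamma> 1 = \<gamma> 0"
  by (simp_all add: path_inv_def)

text \<open>The subdivision for P is squeezed into the first half, the one for Q into the second.
  Subdivision points increase from 0 to 1, which yields the bounds on a and b that the formulas for
  \<open>\<diamondop>\<close> on each half ask for.\<close>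

lemma piecewise_on_unit_join:
  assumes "piecewise_on_unit P" and "piecewise_on_unit Q"
    and P: "\<And>a b. 0 \<le> a \<Longrightarrow> a < b \<Longrightarrow> b \<le> 1 \<Longrightarrow> P a b \<Longrightarrow> R (a / 2) (b / 2)"
    and Q: "\<And>a b. 0 \<le> a \<Longrightarrow> a < b \<Longrightarrow> b \<le> 1 \<Longrightarrow> Q a b \<Longrightarrow> R ((a + 1) / 2) ((b + 1) / 2)"
  shows "piecewise_on_unit R"
proof -
  have bounds: "0 \<le> \<tau> i \<and> \<tau> (Suc i) \<le> 1"
    if "\<tau> 0 = 0" "\<tau> n = 1" "\<forall>i<n. \<tau> i < \<tau> (Suc i)" "i < n" for n i and \<tau> :: "nat \<Rightarrow> real"
  proof -
    have mono: "\<tau> j \<le> \<tau> l" if "j \<le> l" "l \<le> n" for j l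
      using that
    proof (induction l rule: dec_induct)
      case (step l)
      then have "\<tau> l < \<tau> (Suc l)" using \<open>\<forall>i<n. \<tau> i < \<tau> (Suc i)\<close> by simp
      with step show ?case by simp
    qed simp
    from mono[of 0 i] mono[of "Suc i" n] that show ?thesis by auto
  qed
  obtain n \<tau> where \<tau>: "\<tau> 0 = 0" "\<tau> n = 1" "\<forall>i<n. \<tau> i < \<tau> (Suc i)"
    and \<tau>P: "\<And>i. i < n \<Longrightarrow> P (\<tau> i) (\<tau> (Suc i))"
    using assms(1) unfolding piecewise_on_unit_def by blast
  obtain l \<sigma> where \<sigma>: "\<sigma> 0 = 0" "\<sigma> l = 1" "\<forall>i<l. \<sigma> i < \<sigma> (Suc i)"
    and \<sigma>Q: "\<And>i. i < l \<Longrightarrow> Q (\<sigma> i) (\<sigma> (Suc i))"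
    using assms(2) unfolding piecewise_on_unit_def by blast
  \<comment> \<open>At index n both formulas give 1/2, because \<tau> n = 1 and \<sigma> 0 =
    0.\<close>
  define \<rho> where "\<rho> i = (if i \<le> n then \<tau> i / 2 else (\<sigma> (i - n) + 1) / 2)" for i
  have right: "\<rho> (n + i) = (\<sigma> i + 1) / 2" for i
    by (cases i) (auto simp: \<rho>_def \<tau>(2) \<sigma>(1))
  have "\<rho> i < \<rho> (Suc i) \<and> R (\<rho> i) (\<rho> (Suc i))" if "i < n + l" for i
  proof (cases "i < n")
    case True
    then have \<rho>: "\<rho> i = \<tau> i / 2" "\<rho> (Suc i) = \<tau> (Suc i) / 2" by (simp_all add: \<rho>_def)
    have "R (\<tau> i / 2) (\<tau> (Suc i) / 2)"
      using True bounds[OF \<tau> True] \<tau>(3) P[OF _ _ _ \<tau>P[OF True]] by simp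
    then show ?thesis unfolding \<rho> using True \<tau>(3) by (intro conjI) auto
  next
    case False
    with that have "i = n + (i - n)" "i - n < l" by simp_all
    then obtain j where j: "i = n + j" "j < l" by blast
    have \<rho>: "\<rho> i = (\<sigma> j + 1) / 2" "\<rho> (Suc i) = (\<sigma> (Suc j) + 1) / 2"
      unfolding j(1) using right[of j] right[of "Suc j"] by (simp_all only: add_Suc_right)
    have "R ((\<sigma> j + 1) / 2) ((\<sigma> (Suc j) + 1) / 2)"
      using j(2) bounds[OF \<sigma> j(2)] \<sigma>(3) Q[OF _ _ _ \<sigma>Q[OF j(2)]] by blast
    then show ?thesis unfolding \<rho> using j(2) \<sigma>(3) by (intro conjI) auto
  qed
  moreover have "\<rho> 0 = 0" "\<rho> (n + l) = 1"
    using \<tau> \<sigma> right[of l] by (simp_all add: \<rho>_def)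
  ultimately show ?thesis
    unfolding piecewise_on_unit_def by (intro exI[of _ "n + l"] exI[of _ \<rho>]) simp
qed

section \<open>Affine substitutions in the pieces of a path\<close>

lemma Cr_piece_affine:
  assumes "Cr_piece r M \<gamma> a b" and "k > 0"
    and "\<And>s. s \<in> {a'..b'} \<Longrightarrow> k * s + c \<in> {a..b} \<and> \<gamma>' s = \<gamma> (k * s + c)"
  shows "Cr_piece r M \<gamma>' a' b'"
  unfolding Cr_piece_def
proof
  fix t assume t: "t \<in> {a'..b'}"
  then obtain U \<phi> where "(U, \<phi>) \<in> charts M" "\<gamma> (k * t + c) \<in> U"
    and near: "Cr_near r (\<phi> \<circ> \<gamma>) {a..b} (k * t + c)"
    using assms(1,3) unfolding Cr_piece_def by blast
  moreover have "Cr_near r (\<phi> \<circ> \<gamma>') {a'..b'} t"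
    by (rule Cr_near_affine[OF near \<open>k > 0\<close>, where m = 1 and d = 0]) (use assms(3) in auto)
  ultimately show "\<exists>(U, \<phi>)\<in>charts M. \<gamma>' t \<in> U \<and> Cr_near r (\<phi> \<circ> \<gamma>') {a'..b'} t"
    using assms(3)[OF t] by auto
qed

text \<open>This is the chain rule for s \<mapsto> k s + c and for its inverse. The equivalence
  transfers the absence of a derivative as well as its existence, and
  \<open>vector_derivative\<close> makes sense of both.\<close>

lemma has_vector_derivative_affine_iff:
  fixes f :: "real \<Rightarrow> 'a::real_normed_vector"
  assumes "k > 0" and "s \<in> {a..b}" and eq: "\<And>s. s \<in> {a..b} \<Longrightarrow> f' s = f (k * s + c)"
  shows "(f' has_vector_derivative D) (at s within {a..b}) \<longleftrightarrow>
    (f has_vector_derivative D /\<^sub>R k) (at (k * s + c) within {k * a + c..k * b + c})"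
proof
  have im: "(\<lambda>s. k * s + c) ` {a..b} = {k * a + c..k * b + c}"
    using \<open>k > 0\<close> assms(2) by (simp add: image_affinity_atLeastAtMost)
  have im': "(\<lambda>u. (u - c) / k) ` {k * a + c..k * b + c} = {a..b}"
    using \<open>k > 0\<close> by (simp flip: im add: image_image)
  show "(f' has_vector_derivative D) (at s within {a..b})"
    if "(f has_vector_derivative D /\<^sub>R k) (at (k * s + c) within {k * a + c..k * b + c})"
  proof -
    have "((\<lambda>s. k * s + c) has_vector_derivative k) (at s within {a..b})"
      by (auto intro!: derivative_eq_intros)
    from vector_diff_chain_within[OF this, of f "D /\<^sub>R k"] that
    have "(f \<circ> (\<lambda>s. k * s + c) has_vector_derivative D) (at s within {a..b})"
      using \<open>k > 0\<close> by (simp add: im)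
    then show ?thesis
      by (rule has_vector_derivative_transform[rotated 2]) (use assms(2) eq in auto)
  qed
  show "(f has_vector_derivative D /\<^sub>R k) (at (k * s + c) within {k * a + c..k * b + c})"
    if "(f' has_vector_derivative D) (at s within {a..b})"
  proof -
    have "((\<lambda>u. (u - c) / k) has_vector_derivative inverse k)
        (at (k * s + c) within {k * a + c..k * b + c})"
      using \<open>k > 0\<close> by (auto intro!: derivative_eq_intros simp: field_simps)
    from vector_diff_chain_within[OF this, of f' D] that
    have "(f' \<circ> (\<lambda>u. (u - c) / k) has_vector_derivative D /\<^sub>R k)
        (at (k * s + c) within {k * a + c..k * b + c})"
      using \<open>k > 0\<close> by (simp add: im')
    then show ?thesis
    proof (rule has_vector_derivative_transform[rotated 2])
      show "k * s + c \<in> {k * a + c..k * b + c}"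
        using assms(1,2) by simp
      show "f u = (f' \<circ> (\<lambda>u. (u - c) / k)) u" if u: "u \<in> {k * a + c..k * b + c}" for u
      proof -
        have "(u - c) / k \<in> {a..b}" using im' u by blast
        from eq[OF this] \<open>k > 0\<close> show ?thesis by simp
      qed
    qed
  qed
qed

text \<open>\<open>embedded_piece\<close> asks that \<open>vector_derivative\<close> be nonzero in
  every chart around the point, without asserting that a derivative exists. As
  \<open>vector_derivative\<close> is a choice, points with and without a derivative are treated
  separately.\<close>

lemma embedded_piece_affine:
  assumes "embedded_piece M \<gamma> (k * a + c) (k * b + c)" and "k > 0" and "a < b"
    and eq: "\<And>s. s \<in> {a..b} \<Longrightarrow> \<gamma>' s = \<gamma> (k * s + c)"
  shows "embedded_piece M \<gamma>' a b"
proof -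
  let ?I = "{a..b}" and ?J = "{k * a + c..k * b + c}"
  have "homeomorphic_maps (top_of_set ?I) (top_of_set ?J) (\<lambda>s. k * s + c) (\<lambda>u. (u - c) / k)"
    using \<open>k > 0\<close> unfolding homeomorphic_maps_def
    by (auto simp: field_simps intro!: continuous_intros)
  then have hom: "homeomorphic_map (top_of_set ?I) (top_of_set ?J) (\<lambda>s. k * s + c)"
    by (rule homeomorphic_maps_imp_map)
  have "embedding_map (top_of_set ?I) (top_of_set ?J) (\<lambda>s. k * s + c)"
    unfolding embedding_map_def homeomorphic_imp_surjective_map[OF hom] subtopology_topspace
    by (rule hom)
  then have "embedding_map (top_of_set ?I) (mtop M) (\<gamma> \<circ> (\<lambda>s. k * s + c))"
    by (rule embedding_map_compose) (use assms(1) in \<open>simp add: embedded_piece_def\<close>)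
  then have "embedding_map (top_of_set ?I) (mtop M) \<gamma>'"
    by (rule embedding_map_eq) (simp add: eq)
  moreover have "vector_derivative (\<phi> \<circ> \<gamma>') (at t within ?I) \<noteq> 0"
    if t: "t \<in> ?I" and "(U, \<phi>) \<in> charts M" "\<gamma>' t \<in> U" for t U \<phi>
  proof
    let ?t = "at (k * t + c) within ?J"
    have iff: "(\<phi> \<circ> \<gamma>' has_vector_derivative D) (at t within ?I) \<longleftrightarrow>
        (\<phi> \<circ> \<gamma> has_vector_derivative D /\<^sub>R k) ?t" for D
      using \<open>k > 0\<close> t eq by (intro has_vector_derivative_affine_iff) auto
    have kt: "k * t + c \<in> ?J"
      using t \<open>k > 0\<close> by simp
    have nonzero: "vector_derivative (\<phi> \<circ> \<gamma>) ?t \<noteq> 0"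
      using assms(1) kt that(2,3) eq[OF t] unfolding embedded_piece_def by auto
    assume zero: "vector_derivative (\<phi> \<circ> \<gamma>') (at t within ?I) = 0"
    show False
    proof (cases "\<exists>D. (\<phi> \<circ> \<gamma>' has_vector_derivative D) (at t within ?I)")
      case True
      then have "(\<phi> \<circ> \<gamma>' has_vector_derivative 0) (at t within ?I)"
        unfolding vector_derivative_def[of "\<phi> \<circ> \<gamma>'"] using zero
        by (metis someI_ex vector_derivative_def)
      then have "(\<phi> \<circ> \<gamma> has_vector_derivative 0) ?t"
        by (simp add: iff)
      \<comment> \<open>Derivatives within a nondegenerate interval are unique, so the chosen value
        is 0; here a < b enters.\<close>
      then have "vector_derivative (\<phi> \<circ> \<gamma>) ?t = 0"
        using vector_derivative_within_cbox[of "k * a + c" "k * b + c" "k * t + c" "\<phi> \<circ> \<gamma>" 0]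
          \<open>k > 0\<close> \<open>a < b\<close> kt by simp
      with nonzero show False by simp
    next
      case False
      then have none: "\<not> (\<phi> \<circ> \<gamma>' has_vector_derivative D) (at t within ?I)" for D by blast
      have "\<not> (\<phi> \<circ> \<gamma> has_vector_derivative D) ?t" for D
        using none[of "k *\<^sub>R D"] \<open>k > 0\<close> by (simp add: iff)
      \<comment> \<open>Both values are choices from the same constantly false predicate, hence
        equal.\<close>
      with none have "vector_derivative (\<phi> \<circ> \<gamma>) ?t = vector_derivative (\<phi> \<circ> \<gamma>') (at t within ?I)"
        unfolding vector_derivative_def by simp
      with zero nonzero show False by simp
    qed
  qed
  ultimately show ?thesis
    unfolding embedded_piece_def by auto
qed

lemma pathin_path_prod:
  assumes "pathin X p" and "pathin X q" and "p 1 = q 0"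
  shows "pathin X (p \<diamondop> q)"
proof -
  let ?T01 = "top_of_set {0..1::real}"
  have "continuous_map ?T01 X (\<lambda>x. if x \<le> 1/2 then (p \<circ> (\<lambda>t. 2 * t)) x else (q \<circ> (\<lambda>t. 2 * t - 1)) x)"
  proof (intro continuous_map_cases_le continuous_map_compose, force, force)
    show "continuous_map (subtopology ?T01 {x \<in> topspace ?T01. x \<le> 1/2}) ?T01 ((*) 2)"
      and "continuous_map (subtopology ?T01 {x \<in> topspace ?T01. 1/2 \<le> x}) ?T01 (\<lambda>t. 2 * t - 1)"
      by (auto simp: continuous_map_in_subtopology continuous_map_from_subtopology
          intro!: continuous_intros)
    show "continuous_map ?T01 X p" "continuous_map ?T01 X q"
      using assms by (auto simp: pathin_def)
    show "(p \<circ> (\<lambda>t. 2 * t)) x = (q \<circ> (\<lambda>t. 2 * t - 1)) x" if "x = 1/2" for x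
      using assms(3) unfolding that by simp
  qed
  then show ?thesis
    unfolding pathin_def by (rule continuous_map_eq) (simp add: path_prod_def)
qed

lemma pw_path_path_prod:
  assumes p: "pw_path r emb M p" and q: "pw_path r emb M q" and pq: "p 1 = q 0"
  shows "pw_path r emb M (p \<diamondop> q)"
proof -
  let ?Q = "\<lambda>\<gamma> a b. Cr_piece r M \<gamma> a b \<and>
       (emb \<longrightarrow> (\<exists>x. \<forall>t\<in>{a..b}. \<gamma> t = x) \<or> embedded_piece M \<gamma> a b)"
  \<comment> \<open>One claim serves both halves: \<open>p\<close> is used with shift 0 and
    \<open>q\<close> with shift -1, both at slope 2.\<close>
  have affine: "?Q \<gamma>' a' b'" if "?Q \<gamma> (2 * a' + c) (2 * b' + c)" "a' < b'"
    "\<And>s. s \<in> {a'..b'} \<Longrightarrow> \<gamma>' s = \<gamma> (2 * s + c)" for \<gamma> \<gamma>' :: "real \<Rightarrow> 'a" and a' b' c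
  proof (intro conjI impI)
    show "Cr_piece r M \<gamma>' a' b'"
      using that by (intro Cr_piece_affine[of r M \<gamma> "2 * a' + c" "2 * b' + c" 2 a' b' c]) auto
    assume emb
    with that(1) have "(\<exists>x. \<forall>t\<in>{2 * a' + c..2 * b' + c}. \<gamma> t = x) \<or>
        embedded_piece M \<gamma> (2 * a' + c) (2 * b' + c)"
      by simp
    then show "(\<exists>x. \<forall>t\<in>{a'..b'}. \<gamma>' t = x) \<or> embedded_piece M \<gamma>' a' b'"
    proof
      assume "\<exists>x. \<forall>t\<in>{2 * a' + c..2 * b' + c}. \<gamma> t = x"
      then obtain x where "\<forall>t\<in>{2 * a' + c..2 * b' + c}. \<gamma> t = x" ..
      then have "\<forall>t\<in>{a'..b'}. \<gamma>' t = x" using that(3) by auto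
      then show ?thesis by blast
    next
      assume "embedded_piece M \<gamma> (2 * a' + c) (2 * b' + c)"
      from embedded_piece_affine[OF this _ that(2,3)] show ?thesis by simp
    qed
  qed
  have "piecewise_on_unit (?Q (p \<diamondop> q))"
  proof (rule piecewise_on_unit_join[of "?Q p" "?Q q"])
    show "piecewise_on_unit (?Q p)" "piecewise_on_unit (?Q q)"
      using p q by (simp_all only: pw_path_def)
    show "?Q (p \<diamondop> q) (a / 2) (b / 2)" if "0 \<le> a" "a < b" "b \<le> 1" "?Q p a b" for a b
      by (rule affine[of p _ 0]) (use that in \<open>simp_all add: path_prod_left\<close>)
    show "?Q (p \<diamondop> q) ((a + 1) / 2) ((b + 1) / 2)" if "0 \<le> a" "a < b" "b \<le> 1" "?Q q a b" for a b
      by (rule affine[of q _ "-1"])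
        (use that in \<open>simp_all add: path_prod_right[of p q, OF pq] field_simps\<close>)
  qed
  moreover have "p \<diamondop> q \<in> extensional {0..1}"
    by (simp add: path_prod_def)
  ultimately show ?thesis
    using p q pathin_path_prod[of "mtop M" p q, OF _ _ pq] by (simp only: pw_path_def)
qed

section \<open>Piecewise diffeomorphisms of the unit interval\<close>

lemma pw_diffeo_range:
  assumes "pw_diffeo r \<phi>" and "t \<in> {0..1}"
  shows "\<phi> t \<in> {0..1}"
  using assms by (auto simp: pw_diffeo_def bij_betw_def)

text \<open>A monotone map onto [0,1] takes its extreme values at the ends.\<close>

lemma pw_diffeo_ends:
  assumes "pw_diffeo r \<phi>"
  shows "\<phi> 0 = 0" and "\<phi> 1 = 1"
proof -
  have mono: "\<phi> s \<le> \<phi> t" if "s \<le> t" "s \<in> {0..1}" "t \<in> {0..1}" for s t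
    using assms that by (auto simp: pw_diffeo_def strict_mono_on_def le_less)
  have im: "\<phi> ` {0..1} = {0..1}"
    using assms by (simp add: pw_diffeo_def bij_betw_def)
  have "0 \<in> \<phi> ` {0..1}" "1 \<in> \<phi> ` {0..1}"
    by (simp_all add: im)
  then obtain s t where "s \<in> {0..1}" "\<phi> s = 0" "t \<in> {0..1}" "\<phi> t = 1"
    by (metis imageE)
  then show "\<phi> 0 = 0" "\<phi> 1 = 1"
    using mono[of 0 s] mono[of t 1] pw_diffeo_range[OF assms, of 0]
      pw_diffeo_range[OF assms, of 1] by auto
qed

lemma pw_diffeo_ident: "pw_diffeo r (\<lambda>t. t)"
proof -
  have pw: "piecewise_on_unit Q" if "Q 0 1" for Q
    unfolding piecewise_on_unit_def using that
    by (intro exI[of _ "Suc 0"] exI[of _ real]) simp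
  have inv: "inv_into {0..1} (\<lambda>t. t) x = x" if "x \<in> {0..1}" for x :: real
    using that by (intro inv_into_f_eq) auto
  \<comment> \<open>The inverse is known to be the identity on [0,1] only, so regularity is
    transferred by the congruence case of \<open>Cr_near_affine\<close>.\<close>
  have "Cr_near r (inv_into {0..1} (\<lambda>t. t)) {0..1} t" for t :: real
    by (rule Cr_near_affine[of r "\<lambda>t. t" "{0..1}" 1 t 0 _ _ 1 0])
      (auto simp: Cr_near_ident inv)
  then show ?thesis
    unfolding pw_diffeo_def
    by (auto intro!: pw strict_mono_onI simp: Cr_near_ident bij_betw_def)
qed

text \<open>This is the parametrization of a product induced by those of its factors. Written as a
  product of paths in [0,1], it inherits the evaluation rules of
  \<open>\<diamondop>\<close>.\<close>

definition diffeo_join :: "(real \<Rightarrow> real) \<Rightarrow> (real \<Rightarrow> real) \<Rightarrow> real \<Rightarrow> real" where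
  "diffeo_join \<phi> \<psi> = (\<lambda>t. \<phi> t / 2) \<diamondop> (\<lambda>t. (\<psi> t + 1) / 2)"

text \<open>Allowing any \<xi> that agrees with the join on [0,1] makes the lemma applicable to the
  inverse of a join, which is identified on that interval with the join of the inverses. The outer
  factor 1/2 comes from the halved values.\<close>

lemma piecewise_Cr_diffeo_join:
  assumes "piecewise_on_unit (\<lambda>a b. \<forall>t\<in>{a..b}. Cr_near r \<phi> {a..b} t)"
    and "piecewise_on_unit (\<lambda>a b. \<forall>t\<in>{a..b}. Cr_near r \<psi> {a..b} t)"
    and "\<phi> 1 = 1" and "\<psi> 0 = 0"
    and \<xi>: "\<And>t. t \<in> {0..1} \<Longrightarrow> \<xi> t = diffeo_join \<phi> \<psi> t"
  shows "piecewise_on_unit (\<lambda>a b. \<forall>t\<in>{a..b}. Cr_near r \<xi> {a..b} t)"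
proof (rule piecewise_on_unit_join[OF assms(1,2)]; intro ballI)
  fix a b t :: real
  assume ab: "0 \<le> a" "a < b" "b \<le> 1"
  show "Cr_near r \<xi> {a / 2..b / 2} t"
    if "\<forall>t\<in>{a..b}. Cr_near r \<phi> {a..b} t" "t \<in> {a / 2..b / 2}"
    by (rule Cr_near_affine[of r \<phi> "{a..b}" 2 t 0 _ _ "1/2" 0])
      (use that ab in \<open>auto simp: \<xi> diffeo_join_def path_prod_left\<close>)
  show "Cr_near r \<xi> {(a + 1) / 2..(b + 1) / 2} t"
    if "\<forall>t\<in>{a..b}. Cr_near r \<psi> {a..b} t" "t \<in> {(a + 1) / 2..(b + 1) / 2}"
    by (rule Cr_near_affine[of r \<psi> "{a..b}" 2 t "-1" _ _ "1/2" "1/2"])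
      (use that ab assms(3,4) in \<open>auto simp: \<xi> diffeo_join_def path_prod_right\<close>)
qed

text \<open>The inverse of a join is the join of the inverses, so one regularity lemma handles the
  map and its inverse.\<close>

lemma pw_diffeo_diffeo_join:
  assumes \<phi>: "pw_diffeo r \<phi>" and \<psi>: "pw_diffeo r \<psi>"
  shows "pw_diffeo r (diffeo_join \<phi> \<psi>)"
proof -
  let ?\<xi> = "diffeo_join \<phi> \<psi>"
  let ?\<phi>' = "inv_into {0..1} \<phi>" and ?\<psi>' = "inv_into {0..1} \<psi>"
  note ends = pw_diffeo_ends[OF \<phi>] pw_diffeo_ends[OF \<psi>]
  note range = pw_diffeo_range[OF \<phi>] pw_diffeo_range[OF \<psi>]
  have left: "?\<xi> t = \<phi> (2 * t) / 2" if "t \<in> {0..1/2}" for t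
    using that by (simp add: diffeo_join_def path_prod_left)
  have right: "?\<xi> t = (\<psi> (2 * t - 1) + 1) / 2" if "t \<in> {1/2..1}" for t
    using that ends by (simp add: diffeo_join_def path_prod_right)
  have im: "\<phi> ` {0..1} = {0..1}" "\<psi> ` {0..1} = {0..1}"
    and inj: "inj_on \<phi> {0..1}" "inj_on \<psi> {0..1}"
    and smono: "strict_mono_on {0..1} \<phi>" "strict_mono_on {0..1} \<psi>"
    using \<phi> \<psi> by (auto simp: pw_diffeo_def bij_betw_def)
  have mono: "strict_mono_on {0..1} ?\<xi>"
  proof (rule strict_mono_onI)
    fix s t :: real assume st: "s \<in> {0..1}" "t \<in> {0..1}" "s < t"
    consider "t \<le> 1/2" | "s \<ge> 1/2" | "s < 1/2" "1/2 < t" by linarith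
    then show "?\<xi> s < ?\<xi> t"
    proof cases
      case 1
      then have "\<phi> (2 * s) < \<phi> (2 * t)"
        using st smono(1) by (auto simp: strict_mono_on_def)
      with 1 st show ?thesis
        using left[of s] left[of t] by auto
    next
      case 2
      then have "\<psi> (2 * s - 1) < \<psi> (2 * t - 1)"
        using st smono(2) by (auto simp: strict_mono_on_def)
      with 2 st show ?thesis
        using right[of s] right[of t] by auto
    next
      case 3
      \<comment> \<open>The two values are separated by 1/2, the value of the join at the
        midpoint.\<close>
      then have "\<phi> (2 * s) < \<phi> 1" "\<psi> 0 < \<psi> (2 * t - 1)"
        using st smono by (auto simp: strict_mono_on_def)
      with 3 st show ?thesis
        using ends left[of s] right[of t] by auto
    qed
  qed
  then have inj\<xi>: "inj_on ?\<xi> {0..1}"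
    by (rule strict_mono_on_imp_inj_on)
  have inv_range: "?\<phi>' y \<in> {0..1}" "?\<psi>' y \<in> {0..1}" if "y \<in> {0..1}" for y
    using that im by (metis inv_into_into)+
  have inv_ends: "?\<phi>' 1 = 1" "?\<psi>' 0 = 0"
    using ends inj by (auto intro!: inv_into_f_eq)
  \<comment> \<open>Being a right inverse with values in [0,1] gives surjectivity and, together with
    injectivity, identifies \<open>inv_into\<close>.\<close>
  have inv: "diffeo_join ?\<phi>' ?\<psi>' y \<in> {0..1} \<and> ?\<xi> (diffeo_join ?\<phi>' ?\<psi>' y) = y"
    if y: "y \<in> {0..1}" for y
  proof (cases "y \<le> 1/2")
    case True
    then have eq: "diffeo_join ?\<phi>' ?\<psi>' y = ?\<phi>' (2 * y) / 2"
      using y by (simp add: diffeo_join_def path_prod_left)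
    have "\<phi> (?\<phi>' (2 * y)) = 2 * y"
      using y True im by (intro f_inv_into_f) auto
    then show ?thesis unfolding eq
      using inv_range(1)[of "2 * y"] y True left[of "?\<phi>' (2 * y) / 2"] by auto
  next
    case False
    then have eq: "diffeo_join ?\<phi>' ?\<psi>' y = (?\<psi>' (2 * y - 1) + 1) / 2"
      using y inv_ends by (simp add: diffeo_join_def path_prod_right)
    have "\<psi> (?\<psi>' (2 * y - 1)) = 2 * y - 1"
      using y False im by (intro f_inv_into_f) auto
    then show ?thesis unfolding eq
      using inv_range(2)[of "2 * y - 1"] y False right[of "(?\<psi>' (2 * y - 1) + 1) / 2"]
      by (auto simp: add_divide_distrib)
  qed
  have "?\<xi> t \<in> {0..1}" if t: "t \<in> {0..1}" for t
  proof (cases "t \<le> 1/2")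
    case True
    then show ?thesis using t range(1)[of "2 * t"] left[of t] by auto
  next
    case False
    then show ?thesis using t range(2)[of "2 * t - 1"] right[of t] by auto
  qed
  moreover have "y \<in> ?\<xi> ` {0..1}" if "y \<in> {0..1}" for y
    using inv[OF that] by (metis imageI)
  ultimately have "?\<xi> ` {0..1} = {0..1}" by blast
  then have "bij_betw ?\<xi> {0..1} {0..1}"
    using inj\<xi> by (simp add: bij_betw_def)
  moreover have "piecewise_on_unit (\<lambda>a b. \<forall>t\<in>{a..b}. Cr_near r ?\<xi> {a..b} t)"
    by (rule piecewise_Cr_diffeo_join[of r \<phi> \<psi>])
      (use \<phi> \<psi> ends in \<open>simp_all add: pw_diffeo_def\<close>)
  moreover have "piecewise_on_unit (\<lambda>a b. \<forall>t\<in>{a..b}. Cr_near r (inv_into {0..1} ?\<xi>) {a..b} t)"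
  proof (rule piecewise_Cr_diffeo_join[of r ?\<phi>' ?\<psi>'])
    show "inv_into {0..1} ?\<xi> y = diffeo_join ?\<phi>' ?\<psi>' y" if "y \<in> {0..1}" for y
      using inv[OF that] by (intro inv_into_f_eq[OF inj\<xi>]) simp_all
  qed (use \<phi> \<psi> inv_ends in \<open>simp_all add: pw_diffeo_def\<close>)
  ultimately show ?thesis
    using mono by (simp add: pw_diffeo_def)
qed

lemma coincide_refl: "coincide r \<gamma> \<gamma>"
  unfolding coincide_def using pw_diffeo_ident by blast

lemma coincide_ends:
  assumes "coincide r p q"
  shows "p 0 = q 0" and "p 1 = q 1"
  using assms pw_diffeo_ends unfolding coincide_def by fastforce+

text \<open>The join of the two parametrizations works for the product. The factors on the right are
  composable because parametrizations fix the ends.\<close>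

lemma coincide_path_prod:
  assumes "coincide r p p'" and "coincide r q q'" and "p 1 = q 0"
  shows "coincide r (p \<diamondop> q) (p' \<diamondop> q')"
proof -
  obtain \<phi> \<psi> where \<phi>: "pw_diffeo r \<phi>" "\<And>t. t \<in> {0..1} \<Longrightarrow> p t = p' (\<phi> t)"
    and \<psi>: "pw_diffeo r \<psi>" "\<And>t. t \<in> {0..1} \<Longrightarrow> q t = q' (\<psi> t)"
    using assms unfolding coincide_def by blast
  have ends': "p' 1 = q' 0"
    using assms coincide_ends by metis
  have "(p \<diamondop> q) t = (p' \<diamondop> q') (diffeo_join \<phi> \<psi> t)" if t: "t \<in> {0..1}" for t
  proof (cases "t \<le> 1/2")
    case True
    then have eq: "diffeo_join \<phi> \<psi> t = \<phi> (2 * t) / 2" "(p \<diamondop> q) t = p' (\<phi> (2 * t))"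
      using t \<phi>(2)[of "2 * t"] by (simp_all add: diffeo_join_def path_prod_left)
    from True t pw_diffeo_range[OF \<phi>(1), of "2 * t"] show ?thesis
      unfolding eq by (simp add: path_prod_left)
  next
    case False
    then have eq: "diffeo_join \<phi> \<psi> t = (\<psi> (2 * t - 1) + 1) / 2" "(p \<diamondop> q) t = q' (\<psi> (2 * t - 1))"
      using t \<psi>(2)[of "2 * t - 1"] assms(3) pw_diffeo_ends[OF \<phi>(1)] pw_diffeo_ends[OF \<psi>(1)]
      by (simp_all add: diffeo_join_def path_prod_right)
    from False t pw_diffeo_range[OF \<psi>(1), of "2 * t - 1"] show ?thesis
      unfolding eq by (simp add: path_prod_right[of p' q', OF ends'] add_divide_distrib)
  qed
  then show ?thesis
    unfolding coincide_def using pw_diffeo_diffeo_join[OF \<phi>(1) \<psi>(1)] by blast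
qed

section \<open>Closure under products, and endpoints of classes\<close>

lemma Pgen_path_prod:
  assumes "p \<in> Pgen r emb M" and "q \<in> Pgen r emb M" and "p 1 = q 0"
  shows "p \<diamondop> q \<in> Pgen r emb M"
proof -
  obtain p' q' where p': "p' \<in> finite_products r emb M" "coincide r p p'"
    and q': "q' \<in> finite_products r emb M" "coincide r q q'"
    using assms unfolding Pgen_def by blast
  have "p' 1 = q' 0"
    using assms(3) coincide_ends p'(2) q'(2) by metis
  with p' q' have "p' \<diamondop> q' \<in> finite_products r emb M"
    by (blast intro: finite_products.prod)
  with coincide_path_prod[OF p'(2) q'(2) assms(3)] pw_path_path_prod[of r emb M p q] assms
  show ?thesis unfolding Pgen_def by blast
qed

lemma edge_in_Pgen: "is_edge r emb M e \<Longrightarrow> e \<in> Pgen r emb M"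
  unfolding Pgen_def using coincide_refl finite_products.edge is_edge_def by blast

lemma Pgen_ends:
  assumes "\<gamma> \<in> Pgen r emb M"
  shows "\<gamma> 0 \<in> topspace (mtop M)" and "\<gamma> 1 \<in> topspace (mtop M)"
  using assms path_start_in_topspace path_finish_in_topspace unfolding Pgen_def pw_path_def
  by blast+

text \<open>Parametrizations fix 0 and 1, and a retracing returns to the point where it is inserted.
  Equality of ends is symmetric, so insertions and deletions are treated alike.\<close>

lemma path_equiv_ends:
  assumes "(p, q) \<in> path_equiv r emb M"
  shows "p 0 = q 0 \<and> p 1 = q 1"
proof -
  have retracing: "\<gamma> 0 = \<gamma>' 0 \<and> \<gamma> 1 = \<gamma>' 1" if "insert_retracing P \<gamma> \<gamma>'" for P and \<gamma> \<gamma>' :: "real \<Rightarrow> 'a"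
    using that by cases simp_all
  have "(p, q) \<in> (path_step r emb M)\<^sup>*"
    using assms by (simp add: path_equiv_def)
  then show ?thesis
  proof induction
    case (step y z)
    then consider "coincide r y z" | "insert_retracing (Pgen r emb M) y z"
      | "insert_retracing (Pgen r emb M) z y"
      by (auto simp: path_step_def)
    then have "y 0 = z 0 \<and> y 1 = z 1"
      by cases (simp_all add: coincide_ends retracing)
    with step.IH show ?case by simp
  qed simp
qed

text \<open>Reflexivity puts q into its own class, hence into that of p, and related paths share
  their ends. This makes the transformation law meaningful on classes.\<close>

lemma path_class_eq_ends:
  assumes "path_class r emb M p = path_class r emb M q" and "q \<in> Pgen r emb M"
  shows "p 0 = q 0" and "p 1 = q 1"
proof -
  have "q \<in> path_class r emb M q"
    using assms(2) by (simp add: path_class_def path_equiv_def)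
  with assms(1) have "q \<in> path_class r emb M p"
    by simp
  then have "(p, q) \<in> path_equiv r emb M"
    by (simp add: path_class_def)
  from path_equiv_ends[OF this] show "p 0 = q 0" "p 1 = q 1" by simp_all
qed

lemma path_class_in_groupoid:
  "\<gamma> \<in> Pgen r emb M \<Longrightarrow> path_class r emb M \<gamma> \<in> path_groupoid r emb M"
  unfolding path_class_def path_groupoid_def by (rule quotientI)

lemma path_groupoidE:
  assumes "X \<in> path_groupoid r emb M"
  obtains \<gamma> where "\<gamma> \<in> Pgen r emb M" and "X = path_class r emb M \<gamma>"
  using assms unfolding path_class_def path_groupoid_def by (rule quotientE)

section \<open>The gauge action\<close>

text \<open>A class does not come with endpoints, so they are read off a chosen representative. The
  restriction to \<open>path_groupoid\<close> makes the result extensional, as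
  \<open>connections\<close> demands.\<close>

definition gauge_act ::
  "regularity \<Rightarrow> bool \<Rightarrow> ('m, 'e::real_normed_vector) mfd \<Rightarrow> 'g monoid \<Rightarrow>
   ((real \<Rightarrow> 'm) set \<Rightarrow> 'g) \<Rightarrow> ('m \<Rightarrow> 'g) \<Rightarrow> (real \<Rightarrow> 'm) set \<Rightarrow> 'g" where
  "gauge_act r emb M G A g = (\<lambda>X\<in>path_groupoid r emb M.
     let \<gamma> = SOME \<gamma>. \<gamma> \<in> Pgen r emb M \<and> path_class r emb M \<gamma> = X
     in inv\<^bsub>G\<^esub> (g (\<gamma> 0)) \<otimes>\<^bsub>G\<^esub> A X \<otimes>\<^bsub>G\<^esub> g (\<gamma> 1))"

lemma gauge_act_path_class:
  assumes "\<gamma> \<in> Pgen r emb M"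
  shows "gauge_act r emb M G A g (path_class r emb M \<gamma>) =
    inv\<^bsub>G\<^esub> (g (\<gamma> 0)) \<otimes>\<^bsub>G\<^esub> A (path_class r emb M \<gamma>) \<otimes>\<^bsub>G\<^esub> g (\<gamma> 1)"
proof -
  define \<delta> where "\<delta> = (SOME \<delta>. \<delta> \<in> Pgen r emb M \<and> path_class r emb M \<delta> = path_class r emb M \<gamma>)"
  have "\<delta> \<in> Pgen r emb M \<and> path_class r emb M \<delta> = path_class r emb M \<gamma>"
    unfolding \<delta>_def by (rule someI[of _ \<gamma>]) (use assms in simp)
  then have "\<delta> 0 = \<gamma> 0" "\<delta> 1 = \<gamma> 1"
    using path_class_eq_ends assms by metis+
  then show ?thesis
    using path_class_in_groupoid[OF assms] by (simp add: gauge_act_def Let_def \<delta>_def)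
qed

lemma gauge_transforms_ends:
  assumes "g \<in> gauge_transforms M G" and "\<gamma> \<in> Pgen r emb M"
  shows "g (\<gamma> 0) \<in> carrier G" and "g (\<gamma> 1) \<in> carrier G"
  using assms Pgen_ends[OF assms(2)] by (auto simp: gauge_transforms_def)

lemma connections_closed:
  assumes "A \<in> connections r emb M G" and "\<gamma> \<in> Pgen r emb M"
  shows "A (path_class r emb M \<gamma>) \<in> carrier G"
  using assms(1) path_class_in_groupoid[OF assms(2)] by (auto simp: connections_def)

lemma connections_eqI:
  assumes "A \<in> connections r emb M G" and "B \<in> connections r emb M G"
    and "\<And>\<gamma>. \<gamma> \<in> Pgen r emb M \<Longrightarrow> A (path_class r emb M \<gamma>) = B (path_class r emb M \<gamma>)"
  shows "A = B"
proof (rule PiE_ext)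
  show "A \<in> path_groupoid r emb M \<rightarrow>\<^sub>E carrier G" "B \<in> path_groupoid r emb M \<rightarrow>\<^sub>E carrier G"
    using assms(1,2) by (simp_all add: connections_def)
  show "A X = B X" if "X \<in> path_groupoid r emb M" for X
    using path_groupoidE[OF that] assms(3) by metis
qed

lemma (in group) conj_mult_cancel:
  assumes "x \<in> carrier G" "a \<in> carrier G" "y \<in> carrier G" "b \<in> carrier G" "z \<in> carrier G"
  shows "(inv x \<otimes> a \<otimes> y) \<otimes> (inv y \<otimes> b \<otimes> z) = inv x \<otimes> (a \<otimes> b) \<otimes> z"
proof -
  have "(inv x \<otimes> a \<otimes> y) \<otimes> (inv y \<otimes> b \<otimes> z) = inv x \<otimes> a \<otimes> (y \<otimes> inv y) \<otimes> b \<otimes> z"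
    using assms by (simp only: m_assoc m_closed inv_closed)
  then show ?thesis using assms by (simp add: m_assoc)
qed

text \<open>Used in G for the action of inverse gauge transforms, and in G^n for the inverses of
  translations.\<close>

lemma (in group) two_sided_translation_cancel:
  assumes "x \<in> carrier G" "a \<in> carrier G" "y \<in> carrier G"
  shows "x \<otimes> (inv x \<otimes> a \<otimes> y) \<otimes> inv y = a"
proof -
  have "x \<otimes> (inv x \<otimes> a \<otimes> y) \<otimes> inv y = (x \<otimes> inv x) \<otimes> a \<otimes> (y \<otimes> inv y)"
    using assms by (simp only: m_assoc m_closed inv_closed)
  then show ?thesis using assms by simp
qed

lemma gauge_act_in_connections:
  assumes "group G" and "A \<in> connections r emb M G" and "g \<in> gauge_transforms M G"
  shows "gauge_act r emb M G A g \<in> connections r emb M G"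
proof -
  interpret group G by fact
  have closed: "gauge_act r emb M G A g (path_class r emb M \<gamma>) \<in> carrier G"
    if "\<gamma> \<in> Pgen r emb M" for \<gamma>
    using gauge_transforms_ends[OF assms(3) that] connections_closed[OF assms(2) that]
    by (simp add: gauge_act_path_class[OF that])
  have "gauge_act r emb M G A g X \<in> carrier G" if "X \<in> path_groupoid r emb M" for X
    using path_groupoidE[OF that] closed by metis
  then have "gauge_act r emb M G A g \<in> path_groupoid r emb M \<rightarrow>\<^sub>E carrier G"
    by (auto simp: gauge_act_def)
  moreover have "gauge_act r emb M G A g (path_class r emb M (p \<diamondop> q)) =
      gauge_act r emb M G A g (path_class r emb M p) \<otimes>\<^bsub>G\<^esub> gauge_act r emb M G A g (path_class r emb M q)"
    if p: "p \<in> Pgen r emb M" and q: "q \<in> Pgen r emb M" and pq: "p 1 = q 0" for p q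
  proof -
    have "A (path_class r emb M (p \<diamondop> q)) = A (path_class r emb M p) \<otimes>\<^bsub>G\<^esub> A (path_class r emb M q)"
      using assms(2) p q pq by (simp add: connections_def)
    then show ?thesis
      using gauge_transforms_ends[OF assms(3) p] gauge_transforms_ends[OF assms(3) q] pq
        connections_closed[OF assms(2) p] connections_closed[OF assms(2) q]
      by (simp add: gauge_act_path_class[OF Pgen_path_prod[OF p q pq]] gauge_act_path_class[OF p]
          gauge_act_path_class[OF q] conj_mult_cancel)
  qed
  ultimately show ?thesis
    unfolding connections_def by blast
qed

text \<open>Connections are determined by their values on classes of paths and \<Theta> is
  extensional, so the law leaves a single candidate. Existence and uniqueness become one equation,
  and the remaining claims can be proved for \<open>gauge_act\<close>.\<close>

lemma is_gauge_action_iff: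
  assumes "group G"
  shows "is_gauge_action r emb M G \<Theta> \<longleftrightarrow>
    \<Theta> = (\<lambda>(A, g)\<in>connections r emb M G \<times> gauge_transforms M G. gauge_act r emb M G A g)"
    (is "_ \<longleftrightarrow> \<Theta> = ?\<Theta>")
proof
  assume act: "is_gauge_action r emb M G \<Theta>"
  show "\<Theta> = ?\<Theta>"
  proof (rule extensionalityI)
    show "\<Theta> \<in> extensional (connections r emb M G \<times> gauge_transforms M G)"
      "?\<Theta> \<in> extensional (connections r emb M G \<times> gauge_transforms M G)"
      using act by (auto simp: is_gauge_action_def PiE_iff)
    fix x assume x: "x \<in> connections r emb M G \<times> gauge_transforms M G"
    obtain A g where Ag: "x = (A, g)" by (cases x)
    have "\<Theta> (A, g) \<in> connections r emb M G"
      using act x by (auto simp: is_gauge_action_def Ag)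
    moreover have "gauge_act r emb M G A g \<in> connections r emb M G"
      using assms x by (auto simp: Ag intro: gauge_act_in_connections)
    ultimately have "\<Theta> (A, g) = gauge_act r emb M G A g"
      using act x
      by (intro connections_eqI) (auto simp: is_gauge_action_def gauge_act_path_class Ag)
    then show "\<Theta> x = ?\<Theta> x" using x by (simp add: Ag)
  qed
next
  assume "\<Theta> = ?\<Theta>"
  then show "is_gauge_action r emb M G \<Theta>"
    using gauge_act_in_connections[OF assms]
    by (auto simp: is_gauge_action_def gauge_act_path_class)
qed

section \<open>Inverse gauge transforms\<close>

lemma gauge_inverse_in_gauge_transforms:
  assumes "group G" and "g \<in> gauge_transforms M G"
  shows "gauge_inverse M G g \<in> gauge_transforms M G"
  using assms(2) group.inv_closed[OF assms(1)]
  by (auto simp: gauge_inverse_def gauge_transforms_def PiE_iff)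

lemma gauge_inverse_gauge_inverse:
  assumes "group G" and "g \<in> gauge_transforms M G"
  shows "gauge_inverse M G (gauge_inverse M G g) = g"
  using assms by (auto simp: gauge_inverse_def gauge_transforms_def group.inv_inv PiE_iff
      extensional_def fun_eq_iff)

text \<open>Applied to the inverse gauge transform, with \<open>gauge_inverse_gauge_inverse\<close>,
  it also gives the composition in the other order.\<close>

lemma gauge_act_gauge_inverse:
  assumes "group G" and A: "A \<in> connections r emb M G" and g: "g \<in> gauge_transforms M G"
  shows "gauge_act r emb M G (gauge_act r emb M G A g) (gauge_inverse M G g) = A"
proof (rule connections_eqI)
  interpret group G by fact
  show "gauge_act r emb M G (gauge_act r emb M G A g) (gauge_inverse M G g) \<in> connections r emb M G"
    using assms by (intro gauge_act_in_connections gauge_inverse_in_gauge_transforms)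
  fix \<gamma> assume \<gamma>: "\<gamma> \<in> Pgen r emb M"
  show "gauge_act r emb M G (gauge_act r emb M G A g) (gauge_inverse M G g) (path_class r emb M \<gamma>) =
      A (path_class r emb M \<gamma>)"
    using gauge_transforms_ends[OF g \<gamma>] connections_closed[OF A \<gamma>] Pgen_ends[OF \<gamma>]
    by (simp add: gauge_act_path_class[OF \<gamma>] gauge_inverse_def two_sided_translation_cancel)
qed fact

section \<open>Continuity\<close>

lemma lie_group_continuous_mult:
  assumes "lie_group G L" and "continuous_map X (mtop L) f" and "continuous_map X (mtop L) h"
  shows "continuous_map X (mtop L) (\<lambda>x. f x \<otimes>\<^bsub>G\<^esub> h x)"
proof -
  have "continuous_map (prod_topology (mtop L) (mtop L)) (mtop L) (\<lambda>(x, y). x \<otimes>\<^bsub>G\<^esub> y)"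
    using assms(1) by (simp add: lie_group_def)
  from continuous_map_compose[OF continuous_map_pairedI[OF assms(2,3)] this]
  show ?thesis by (simp add: o_def)
qed

lemma lie_group_continuous_inv:
  assumes "lie_group G L" and "continuous_map X (mtop L) f"
  shows "continuous_map X (mtop L) (\<lambda>x. inv\<^bsub>G\<^esub> (f x))"
  using continuous_map_compose[OF assms(2), of "mtop L" "\<lambda>x. inv\<^bsub>G\<^esub> x"] assms(1)
  by (simp add: lie_group_def o_def)

lemma topspace_power_topology:
  "lie_group G L \<Longrightarrow> topspace (power_topology L n) = {..<n} \<rightarrow>\<^sub>E carrier G"
  by (simp add: power_topology_def lie_group_def)

lemma topspace_gauge_topology:
  "lie_group G L \<Longrightarrow> topspace (gauge_topology M L) = gauge_transforms M G"
  by (simp add: gauge_topology_def gauge_transforms_def lie_group_def)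

lemma hyph_edge_in_Pgen: "hyph r emb M \<upsilon> \<Longrightarrow> i < length \<upsilon> \<Longrightarrow> \<upsilon> ! i \<in> Pgen r emb M"
  by (simp add: hyph_def edge_in_Pgen)

lemma hyph_proj_in_power:
  assumes "hyph r emb M \<upsilon>" and "A \<in> connections r emb M G"
  shows "hyph_proj r emb M \<upsilon> A \<in> {..<length \<upsilon>} \<rightarrow>\<^sub>E carrier G"
  using connections_closed[OF assms(2) hyph_edge_in_Pgen[OF assms(1)]]
  by (auto simp: hyph_proj_def)

text \<open>The topspace is the union of the generating sets, all of which consist of connections.
  The empty hyph, projecting to the one-point space G^0, supplies the set of all connections as a
  generator.\<close>

lemma topspace_connection_topology:
  assumes "lie_group G L"
  shows "topspace (connection_topology r emb M G L) = connections r emb M G"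
proof -
  have "openin (power_topology L 0) ({..<0} \<rightarrow>\<^sub>E carrier G)"
    by (metis assms openin_topspace topspace_power_topology)
  then have "\<exists>\<upsilon> W. connections r emb M G = {A \<in> connections r emb M G. hyph_proj r emb M \<upsilon> A \<in> W} \<and>
      hyph r emb M \<upsilon> \<and> openin (power_topology L (length \<upsilon>)) W"
    by (intro exI[of _ "[]"] exI[of _ "{..<0} \<rightarrow>\<^sub>E carrier G"]) (auto simp: hyph_def hyph_proj_def)
  then have "connections r emb M G \<in> {{A \<in> connections r emb M G. hyph_proj r emb M \<upsilon> A \<in> W} |\<upsilon> W.
      hyph r emb M \<upsilon> \<and> openin (power_topology L (length \<upsilon>)) W}"
    by (rule CollectI)
  then show ?thesis
    unfolding connection_topology_def topology_generated_by_topspace by blast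
qed

lemma continuous_map_hyph_proj:
  assumes "lie_group G L" and "hyph r emb M \<upsilon>"
  shows "continuous_map (connection_topology r emb M G L) (power_topology L (length \<upsilon>))
    (hyph_proj r emb M \<upsilon>)"
  unfolding continuous_map topspace_connection_topology[OF assms(1)]
    topspace_power_topology[OF assms(1)]
proof (intro conjI allI impI)
  show "hyph_proj r emb M \<upsilon> ` connections r emb M G \<subseteq> {..<length \<upsilon>} \<rightarrow>\<^sub>E carrier G"
    using hyph_proj_in_power[OF assms(2)] by blast
  show "openin (connection_topology r emb M G L) {A \<in> connections r emb M G. hyph_proj r emb M \<upsilon> A \<in> W}"
    if "openin (power_topology L (length \<upsilon>)) W" for W
    unfolding connection_topology_def
    by (rule topology_generated_by_Basis) (use assms(2) that in blast)
qed

text \<open>This is the universal property of the coarsest topology that makes the hyph projections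
  continuous.\<close>

lemma continuous_map_into_connection_topology:
  assumes "lie_group G L" and "f ` topspace X \<subseteq> connections r emb M G"
    and "\<And>\<upsilon>. hyph r emb M \<upsilon> \<Longrightarrow>
      continuous_map X (power_topology L (length \<upsilon>)) (\<lambda>x. hyph_proj r emb M \<upsilon> (f x))"
  shows "continuous_map X (connection_topology r emb M G L) f"
  unfolding connection_topology_def
proof (rule continuous_on_generated_topo, goal_cases)
  case (1 U)
  then obtain \<upsilon> W where U: "U = {A \<in> connections r emb M G. hyph_proj r emb M \<upsilon> A \<in> W}"
    and "hyph r emb M \<upsilon>" "openin (power_topology L (length \<upsilon>)) W" by blast
  then have "openin X {x \<in> topspace X. hyph_proj r emb M \<upsilon> (f x) \<in> W}"
    using assms(3) openin_continuous_map_preimage by blast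
  moreover have "{x \<in> topspace X. hyph_proj r emb M \<upsilon> (f x) \<in> W} = f -` U \<inter> topspace X"
    using assms(2) by (auto simp: U)
  ultimately show ?case by simp
next
  case 2
  from assms(2) show ?case
    using topspace_connection_topology[OF assms(1), of r emb M]
    by (simp add: connection_topology_def topology_generated_by_topspace)
qed

lemma continuous_map_hyph_eval:
  assumes "lie_group G L" and "hyph r emb M \<upsilon>" and "i < length \<upsilon>"
  shows "continuous_map (connection_topology r emb M G L) (mtop L) (\<lambda>A. A (path_class r emb M (\<upsilon> ! i)))"
proof -
  have "continuous_map (power_topology L (length \<upsilon>)) (mtop L) (\<lambda>x. x i)"
    using continuous_map_product_projection[of i "{..<length \<upsilon>}" "\<lambda>_. mtop L"] assms(3)
    by (simp add: power_topology_def)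
  from continuous_map_compose[OF continuous_map_hyph_proj[OF assms(1,2)] this]
  show ?thesis using assms(3) by (simp add: o_def hyph_proj_def)
qed

lemma hyph_proj_gauge_act:
  assumes "hyph r emb M \<upsilon>"
  shows "hyph_proj r emb M \<upsilon> (gauge_act r emb M G A g) = (\<lambda>i\<in>{..<length \<upsilon>}.
    inv\<^bsub>G\<^esub> (g ((\<upsilon> ! i) 0)) \<otimes>\<^bsub>G\<^esub> A (path_class r emb M (\<upsilon> ! i)) \<otimes>\<^bsub>G\<^esub> g ((\<upsilon> ! i) 1))"
  unfolding hyph_proj_def
  by (rule restrict_ext) (simp add: gauge_act_path_class hyph_edge_in_Pgen[OF assms])

text \<open>Each coordinate of a projection involves one value of A, on an edge of the hyph, and two
  values of g, at the ends of that edge. All three are continuous on the product space, and the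
  group operations preserve continuity.\<close>

lemma continuous_map_gauge_act:
  assumes "lie_group G L"
  shows "continuous_map (prod_topology (connection_topology r emb M G L) (gauge_topology M L))
    (connection_topology r emb M G L) (\<lambda>(A, g). gauge_act r emb M G A g)"
proof (rule continuous_map_into_connection_topology[OF assms])
  let ?X = "prod_topology (connection_topology r emb M G L) (gauge_topology M L)"
  have "group G" using assms by (simp add: lie_group_def)
  then show "(\<lambda>(A, g). gauge_act r emb M G A g) ` topspace ?X \<subseteq> connections r emb M G"
    using assms
    by (auto simp: topspace_connection_topology topspace_gauge_topology gauge_act_in_connections)
  fix \<upsilon> assume \<upsilon>: "hyph r emb M \<upsilon>"
  have gauge: "continuous_map ?X (mtop L) (\<lambda>x. snd x p)" if "p \<in> topspace (mtop M)" for p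
    using continuous_map_compose[OF continuous_map_snd
        continuous_map_product_projection[OF that, of "\<lambda>_. mtop L"]]
    by (simp add: gauge_topology_def o_def)
  have "continuous_map ?X (mtop L) (\<lambda>x. inv\<^bsub>G\<^esub> (snd x ((\<upsilon> ! i) 0)) \<otimes>\<^bsub>G\<^esub>
      fst x (path_class r emb M (\<upsilon> ! i)) \<otimes>\<^bsub>G\<^esub> snd x ((\<upsilon> ! i) 1))" if i: "i < length \<upsilon>" for i
    using Pgen_ends[OF hyph_edge_in_Pgen[OF \<upsilon> i]]
      continuous_map_compose[OF continuous_map_fst continuous_map_hyph_eval[OF assms \<upsilon> i]]
    by (intro lie_group_continuous_mult[OF assms] lie_group_continuous_inv[OF assms] gauge)
      (auto simp: o_def)
  then have "continuous_map ?X (power_topology L (length \<upsilon>)) (\<lambda>x. \<lambda>i\<in>{..<length \<upsilon>}.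
      inv\<^bsub>G\<^esub> (snd x ((\<upsilon> ! i) 0)) \<otimes>\<^bsub>G\<^esub> fst x (path_class r emb M (\<upsilon> ! i)) \<otimes>\<^bsub>G\<^esub> snd x ((\<upsilon> ! i) 1))"
    by (auto simp: power_topology_def continuous_map_componentwise)
  then show "continuous_map ?X (power_topology L (length \<upsilon>))
      (\<lambda>x. hyph_proj r emb M \<upsilon> ((\<lambda>(A, g). gauge_act r emb M G A g) x))"
    by (simp add: hyph_proj_gauge_act[OF \<upsilon>] case_prod_unfold)
qed

lemma homeomorphic_maps_gauge_act:
  assumes "lie_group G L" and g: "g \<in> gauge_transforms M G"
  shows "homeomorphic_maps (connection_topology r emb M G L) (connection_topology r emb M G L)
    (\<lambda>A. gauge_act r emb M G A g) (\<lambda>A. gauge_act r emb M G A (gauge_inverse M G g))"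
proof -
  have "group G" using assms by (simp add: lie_group_def)
  note inv = gauge_inverse_in_gauge_transforms[OF this g]
  have cont: "continuous_map (connection_topology r emb M G L) (connection_topology r emb M G L)
      (\<lambda>A. gauge_act r emb M G A h)" if "h \<in> gauge_transforms M G" for h
  proof -
    \<comment> \<open>Joint continuity is restricted to the slice at h.\<close>
    have "continuous_map (connection_topology r emb M G L)
        (prod_topology (connection_topology r emb M G L) (gauge_topology M L)) (\<lambda>A. (A, h))"
      using that assms(1) by (intro continuous_map_pairedI) (auto simp: topspace_gauge_topology)
    from continuous_map_compose[OF this continuous_map_gauge_act[OF assms(1)]]
    show ?thesis by (simp add: o_def)
  qed
  show ?thesis
    unfolding homeomorphic_maps_def topspace_connection_topology[OF assms(1)]
    using cont[OF g] cont[OF inv] gauge_act_gauge_inverse[OF \<open>group G\<close> _ g]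
      gauge_act_gauge_inverse[OF \<open>group G\<close> _ inv] gauge_inverse_gauge_inverse[OF \<open>group G\<close> g]
    by simp
qed

section \<open>Invariance of the Ashtekar--Lewandowski measure\<close>

lemma space_borel_of [simp]: "space (borel_of X) = topspace X"
  by (simp add: borel_of_def space_measure_of_conv)

lemma openin_in_sets_borel_of: "openin X U \<Longrightarrow> U \<in> sets (borel_of X)"
  unfolding borel_of_def by (subst sets_measure_of) (auto dest: openin_subset)

lemma continuous_map_measurable_borel_of:
  assumes "continuous_map X Y f" and "sets \<mu> = sets (borel_of X)"
  shows "f \<in> measurable \<mu> (borel_of Y)"
  unfolding borel_of_def
proof (rule measurable_measure_of)
  have space: "space \<mu> = topspace X"
    using sets_eq_imp_space_eq[OF assms(2)] by simp
  then show "f \<in> space \<mu> \<rightarrow> topspace Y"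
    using assms(1) by (auto simp: continuous_map_def)
  show "f -` U \<inter> space \<mu> \<in> sets \<mu>" if "U \<in> {U. openin Y U}" for U
  proof -
    have "f -` U \<inter> space \<mu> = {x \<in> topspace X. f x \<in> U}" by (auto simp: space)
    then show ?thesis
      using that assms by (auto intro: openin_in_sets_borel_of openin_continuous_map_preimage)
  qed
qed (auto dest: openin_subset)

lemma homeomorphic_maps_image_image:
  "homeomorphic_maps X Y f f' \<Longrightarrow> S \<subseteq> topspace Y \<Longrightarrow> f ` f' ` S = S"
  by (auto simp: homeomorphic_maps_def subset_iff image_image)

text \<open>Image measures are defined by preimages, whereas open, compact and Borel sets are most
  easily moved as images under the inverse map.\<close>

lemma homeomorphic_maps_vimage:
  assumes "homeomorphic_maps X Y f f'" and "S \<subseteq> topspace Y"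
  shows "f -` S \<inter> topspace X = f' ` S"
proof -
  have "f' y \<in> topspace X" "f (f' y) = y" if "y \<in> S" for y
    using assms that by (auto simp: homeomorphic_maps_def continuous_map_def)
  moreover have "f' (f x) = x" if "x \<in> topspace X" for x
    using assms that by (simp add: homeomorphic_maps_def)
  ultimately show ?thesis by (auto intro: rev_image_eqI)
qed

lemma homeomorphic_maps_image_sets_borel_of:
  assumes "homeomorphic_maps X Y f f'" and "S \<in> sets (borel_of Y)"
  shows "f' ` S \<in> sets (borel_of X)"
proof -
  have S: "S \<subseteq> topspace Y"
    using sets.sets_into_space[OF assms(2)] by simp
  have "f' ` S = f -` S \<inter> space (borel_of X)"
    using homeomorphic_maps_vimage[OF assms(1) S] by simp
  then show ?thesis
    using measurable_sets[OF continuous_map_measurable_borel_of[of X Y f "borel_of X"] assms(2)] assms(1)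
    by (simp add: homeomorphic_maps_def)
qed

text \<open>The set \<open>S\<close> need not be measurable: \<open>emeasure\<close> is \<open>0\<close> on both sides otherwise.\<close>

lemma emeasure_distr_homeomorphic:
  assumes hom: "homeomorphic_maps X Y f f'" and \<mu>: "sets \<mu> = sets (borel_of X)"
    and N: "sets N = sets (borel_of Y)" and S: "S \<subseteq> topspace Y"
  shows "emeasure (distr \<mu> N f) S = emeasure \<mu> (f' ` S)"
proof (cases "S \<in> sets N")
  case True
  have f: "f \<in> measurable \<mu> N"
    using continuous_map_measurable_borel_of[of X Y f \<mu>] hom \<mu> measurable_cong_sets[OF refl N]
    by (auto simp: homeomorphic_maps_def)
  have "f -` S \<inter> space \<mu> = f' ` S"
    using homeomorphic_maps_vimage[OF hom S] sets_eq_imp_space_eq[OF \<mu>] by simp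
  then show ?thesis
    using emeasure_distr[OF f True] by simp
next
  case False
  have "homeomorphic_maps Y X f' f"
    using hom homeomorphic_maps_sym by blast
  \<comment> \<open>If the image of S under f' were measurable, so would be the image of that set
    under f, which is S.\<close>
  from homeomorphic_maps_image_sets_borel_of[OF this, of "f' ` S"] False
  have "f' ` S \<notin> sets \<mu>"
    unfolding homeomorphic_maps_image_image[OF hom S] \<mu> N by blast
  with False show ?thesis by (simp add: emeasure_notin_sets)
qed

text \<open>The maps match open supersets of S with those of its image under f', and compact subsets
  likewise, with equal measures. \<open>N\<close> is fixed only up to its sigma-algebra because
  image measures are formed both over \<open>borel_of\<close> and over \<mu> itself.\<close>

lemma regular_borel_distr_homeomorphic:
  assumes hom: "homeomorphic_maps X Y f f'" and reg: "regular_borel X \<mu>"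
    and N: "sets N = sets (borel_of Y)"
  shows "regular_borel Y (distr \<mu> N f)"
proof -
  let ?D = "distr \<mu> N f"
  have \<mu>: "sets \<mu> = sets (borel_of X)" using reg by (simp add: regular_borel_def)
  note D = emeasure_distr_homeomorphic[OF hom \<mu> N]
  have f: "homeomorphic_map X Y f" and f': "homeomorphic_map Y X f'"
    using hom homeomorphic_maps_map by blast+
  have ff: "f' ` f ` U = U" if "U \<subseteq> topspace X" for U
    using hom that by (metis homeomorphic_maps_image_image homeomorphic_maps_sym)
  have "emeasure ?D S = (INF V\<in>{V. openin Y V \<and> S \<subseteq> V}. emeasure ?D V) \<and>
      emeasure ?D S = (SUP K\<in>{K. compactin Y K \<and> K \<subseteq> S}. emeasure ?D K)"
    if "S \<in> sets ?D" for S
  proof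
    have S: "S \<subseteq> topspace Y"
      using sets.sets_into_space[OF that] sets_eq_imp_space_eq[OF N] by simp
    have "f' ` S \<in> sets \<mu>"
      using homeomorphic_maps_image_sets_borel_of[OF hom, of S] that by (simp add: N \<mu>)
    with reg have outer: "emeasure \<mu> (f' ` S) = (INF U\<in>{U. openin X U \<and> f' ` S \<subseteq> U}. emeasure \<mu> U)"
      and inner: "emeasure \<mu> (f' ` S) = (SUP K\<in>{K. compactin X K \<and> K \<subseteq> f' ` S}. emeasure \<mu> K)"
      unfolding regular_borel_def by blast+
    have fS: "f ` f' ` S = S"
      by (rule homeomorphic_maps_image_image[OF hom S])
    show "emeasure ?D S = (INF V\<in>{V. openin Y V \<and> S \<subseteq> V}. emeasure ?D V)"
      unfolding D[OF S] outer
    proof (rule INF_eq)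
      fix U assume U: "U \<in> {U. openin X U \<and> f' ` S \<subseteq> U}"
      then have "openin Y (f ` U)" "S \<subseteq> f ` U"
        using homeomorphic_map_openness[OF f, of U] openin_subset[of X U]
          image_mono[of "f' ` S" U f] by (simp_all add: fS)
      moreover have "emeasure ?D (f ` U) = emeasure \<mu> U"
        using D[of "f ` U"] ff[of U] U openin_subset[of X U] openin_subset[of Y "f ` U"] calculation(1)
        by simp
      ultimately show "\<exists>V\<in>{V. openin Y V \<and> S \<subseteq> V}. emeasure ?D V \<le> emeasure \<mu> U"
        by (intro bexI[of _ "f ` U"]) auto
    next
      fix V assume V: "V \<in> {V. openin Y V \<and> S \<subseteq> V}"
      then have "openin X (f' ` V)"
        using homeomorphic_map_openness[OF f', of V] openin_subset[of Y V] by auto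
      moreover have "emeasure ?D V = emeasure \<mu> (f' ` V)"
        using D[of V] V openin_subset[of Y V] by simp
      ultimately show "\<exists>U\<in>{U. openin X U \<and> f' ` S \<subseteq> U}. emeasure \<mu> U \<le> emeasure ?D V"
        using V by (intro bexI[of _ "f' ` V"]) auto
    qed
    show "emeasure ?D S = (SUP K\<in>{K. compactin Y K \<and> K \<subseteq> S}. emeasure ?D K)"
      unfolding D[OF S] inner
    proof (rule SUP_eq)
      fix K assume K: "K \<in> {K. compactin X K \<and> K \<subseteq> f' ` S}"
      then have "compactin Y (f ` K)" "f ` K \<subseteq> S"
        using image_compactin[of X K Y f] hom image_mono[of K "f' ` S" f]
        by (simp_all add: fS homeomorphic_maps_def)
      moreover have "emeasure ?D (f ` K) = emeasure \<mu> K"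
        using D[of "f ` K"] ff[of K] K compactin_subset_topspace[of X K]
          compactin_subset_topspace[of Y "f ` K"] calculation(1)
        by simp
      ultimately show "\<exists>K'\<in>{K. compactin Y K \<and> K \<subseteq> S}. emeasure \<mu> K \<le> emeasure ?D K'"
        by (intro bexI[of _ "f ` K"]) auto
    next
      fix K assume K: "K \<in> {K. compactin Y K \<and> K \<subseteq> S}"
      then have "compactin X (f' ` K)"
        using image_compactin[of Y K X f'] hom by (auto simp: homeomorphic_maps_def)
      moreover have "emeasure ?D K = emeasure \<mu> (f' ` K)"
        using D[of K] K S by auto
      ultimately show "\<exists>K'\<in>{K. compactin X K \<and> K \<subseteq> f' ` S}. emeasure ?D K \<le> emeasure \<mu> K'"
        using K by (intro bexI[of _ "f' ` K"]) auto
    qed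
  qed
  moreover have "sets ?D = sets (borel_of Y)" using N by simp
  ultimately show ?thesis
    unfolding regular_borel_def by blast
qed

text \<open>Left invariance of \<open>\<mu>\<close> suffices, since \<open>a\<^sup>-\<^sup>1 y s b\<^sup>-\<^sup>1 = (a\<^sup>-\<^sup>1 y a) (a\<^sup>-\<^sup>1 s b\<^sup>-\<^sup>1)\<close>; no
  unimodularity is needed.\<close>

lemma normalized_haar_distr_translation:
  assumes K: "group K" and X: "topspace X = carrier K" and haar: "normalized_haar K X \<mu>"
    and a: "a \<in> carrier K" and b: "b \<in> carrier K"
    and hom: "homeomorphic_maps X X (\<lambda>x. a \<otimes>\<^bsub>K\<^esub> x \<otimes>\<^bsub>K\<^esub> b) (\<lambda>x. inv\<^bsub>K\<^esub> a \<otimes>\<^bsub>K\<^esub> x \<otimes>\<^bsub>K\<^esub> inv\<^bsub>K\<^esub> b)"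
  shows "normalized_haar K X (distr \<mu> (borel_of X) (\<lambda>x. a \<otimes>\<^bsub>K\<^esub> x \<otimes>\<^bsub>K\<^esub> b))"
proof -
  interpret group K by fact
  let ?T = "\<lambda>x. a \<otimes>\<^bsub>K\<^esub> x \<otimes>\<^bsub>K\<^esub> b" and ?T' = "\<lambda>x. inv\<^bsub>K\<^esub> a \<otimes>\<^bsub>K\<^esub> x \<otimes>\<^bsub>K\<^esub> inv\<^bsub>K\<^esub> b"
  let ?D = "distr \<mu> (borel_of X) ?T"
  have reg: "regular_borel X \<mu>" and mass: "emeasure \<mu> (space \<mu>) = 1"
    and left: "\<And>y S. y \<in> carrier K \<Longrightarrow> S \<in> sets \<mu> \<Longrightarrow>
      emeasure \<mu> ((\<lambda>x. y \<otimes>\<^bsub>K\<^esub> x) ` S) = emeasure \<mu> S"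
    using haar by (auto simp: normalized_haar_def)
  have \<mu>: "sets \<mu> = sets (borel_of X)" using reg by (simp add: regular_borel_def)
  note D = emeasure_distr_homeomorphic[OF hom \<mu> refl]
  have "?T' ` topspace X = topspace X"
    using hom homeomorphic_imp_surjective_map homeomorphic_maps_map by blast
  then have "emeasure ?D (space ?D) = 1"
    using mass sets_eq_imp_space_eq[OF \<mu>] by (simp add: D)
  moreover have "emeasure ?D ((\<lambda>x. y \<otimes>\<^bsub>K\<^esub> x) ` S) = emeasure ?D S"
    if y: "y \<in> carrier K" and S: "S \<in> sets ?D" for y S
  proof -
    let ?y = "inv\<^bsub>K\<^esub> a \<otimes>\<^bsub>K\<^esub> y \<otimes>\<^bsub>K\<^esub> a"
    have SX: "S \<subseteq> carrier K"
      using sets.sets_into_space[OF S] X by simp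
    have "?T' (y \<otimes>\<^bsub>K\<^esub> s) = ?y \<otimes>\<^bsub>K\<^esub> ?T' s" if "s \<in> S" for s
    proof -
      have s: "s \<in> carrier K" using that SX by blast
      have "?y \<otimes>\<^bsub>K\<^esub> ?T' s = inv\<^bsub>K\<^esub> a \<otimes>\<^bsub>K\<^esub> y \<otimes>\<^bsub>K\<^esub> (a \<otimes>\<^bsub>K\<^esub> inv\<^bsub>K\<^esub> a) \<otimes>\<^bsub>K\<^esub> s \<otimes>\<^bsub>K\<^esub> inv\<^bsub>K\<^esub> b"
        using a b y s by (simp only: m_assoc m_closed inv_closed)
      then show ?thesis using a b y s by (simp add: m_assoc)
    qed
    then have "?T' ` (\<lambda>x. y \<otimes>\<^bsub>K\<^esub> x) ` S = (\<lambda>x. ?y \<otimes>\<^bsub>K\<^esub> x) ` ?T' ` S"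
      by (simp add: image_image cong: image_cong)
    moreover have "?T' ` S \<in> sets \<mu>"
      using homeomorphic_maps_image_sets_borel_of[OF hom, of S] S \<mu> by simp
    moreover have "(\<lambda>x. y \<otimes>\<^bsub>K\<^esub> x) ` S \<subseteq> topspace X" "S \<subseteq> topspace X"
      using SX X y by auto
    ultimately show ?thesis
      using left[of ?y "?T' ` S"] a y by (simp add: D)
  qed
  ultimately show ?thesis
    using regular_borel_distr_homeomorphic[OF hom reg refl] by (simp add: normalized_haar_def)
qed

text \<open>The inverse is again a two-sided translation, so one coordinatewise continuity claim and
  one cancellation rule serve both directions.\<close>

lemma homeomorphic_maps_power_translation:
  assumes "lie_group G L" and a: "a \<in> {..<n} \<rightarrow>\<^sub>E carrier G" and b: "b \<in> {..<n} \<rightarrow>\<^sub>E carrier G"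
  defines "K \<equiv> product_group {..<n} (\<lambda>_. G)"
  shows "homeomorphic_maps (power_topology L n) (power_topology L n)
    (\<lambda>x. a \<otimes>\<^bsub>K\<^esub> x \<otimes>\<^bsub>K\<^esub> b) (\<lambda>x. inv\<^bsub>K\<^esub> a \<otimes>\<^bsub>K\<^esub> x \<otimes>\<^bsub>K\<^esub> inv\<^bsub>K\<^esub> b)"
proof -
  have "group G" and top: "topspace (mtop L) = carrier G"
    using assms(1) by (simp_all add: lie_group_def)
  then interpret K: group K
    unfolding K_def by simp
  have carrier: "carrier K = {..<n} \<rightarrow>\<^sub>E carrier G"
    by (simp add: K_def)
  have cont: "continuous_map (power_topology L n) (power_topology L n) (\<lambda>x. c \<otimes>\<^bsub>K\<^esub> x \<otimes>\<^bsub>K\<^esub> d)"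
    if "c \<in> carrier K" "d \<in> carrier K" for c d
  proof -
    have "continuous_map (power_topology L n) (mtop L) (\<lambda>x. c i \<otimes>\<^bsub>G\<^esub> x i \<otimes>\<^bsub>G\<^esub> d i)" if i: "i < n" for i
    proof (intro lie_group_continuous_mult[OF assms(1)])
      show "continuous_map (power_topology L n) (mtop L) (\<lambda>x. x i)"
        using continuous_map_product_projection[of i "{..<n}" "\<lambda>_. mtop L"] i
        by (simp add: power_topology_def)
      show "continuous_map (power_topology L n) (mtop L) (\<lambda>x. c i)"
        "continuous_map (power_topology L n) (mtop L) (\<lambda>x. d i)"
        using \<open>c \<in> carrier K\<close> \<open>d \<in> carrier K\<close> i by (auto simp: carrier top)
    qed
    then show ?thesis
      by (auto simp: power_topology_def continuous_map_componentwise K_def)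
  qed
  show ?thesis
    unfolding homeomorphic_maps_def topspace_power_topology[OF assms(1)] carrier[symmetric]
  proof (intro conjI ballI cont)
    fix x assume x: "x \<in> carrier K"
    show "inv\<^bsub>K\<^esub> a \<otimes>\<^bsub>K\<^esub> (a \<otimes>\<^bsub>K\<^esub> x \<otimes>\<^bsub>K\<^esub> b) \<otimes>\<^bsub>K\<^esub> inv\<^bsub>K\<^esub> b = x"
      using K.two_sided_translation_cancel[of "inv\<^bsub>K\<^esub> a" x b] a b x by (simp add: carrier[symmetric])
    show "a \<otimes>\<^bsub>K\<^esub> (inv\<^bsub>K\<^esub> a \<otimes>\<^bsub>K\<^esub> x \<otimes>\<^bsub>K\<^esub> inv\<^bsub>K\<^esub> b) \<otimes>\<^bsub>K\<^esub> b = x"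
      using K.two_sided_translation_cancel[of a x "inv\<^bsub>K\<^esub> b"] a b x by (simp add: carrier[symmetric])
  qed (use a b in \<open>simp_all add: carrier[symmetric]\<close>)
qed

lemma haar_marginals_distr_gauge_act:
  assumes L: "lie_group G L" and g: "g \<in> gauge_transforms M G"
    and \<mu>: "sets \<mu> = sets (borel_of (connection_topology r emb M G L))"
    and marg: "haar_marginals r emb M G L \<mu>"
  shows "haar_marginals r emb M G L (distr \<mu> \<mu> (\<lambda>A. gauge_act r emb M G A g))"
  unfolding haar_marginals_def
proof (intro allI impI)
  fix \<upsilon> assume \<upsilon>: "hyph r emb M \<upsilon>"
  let ?n = "length \<upsilon>" and ?hp = "hyph_proj r emb M \<upsilon>" and ?act = "\<lambda>A. gauge_act r emb M G A g"
  let ?P = "power_topology L ?n"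
  define K where "K = product_group {..<?n} (\<lambda>_. G)"
  \<comment> \<open>The translation belonging to g: inverses of g at the starting points of the
    edges act on the left, values of g at the end points on the right.\<close>
  define a where "a = (\<lambda>i\<in>{..<?n}. inv\<^bsub>G\<^esub> (g ((\<upsilon> ! i) 0)))"
  define b where "b = (\<lambda>i\<in>{..<?n}. g ((\<upsilon> ! i) 1))"
  have "group G" using L by (simp add: lie_group_def)
  then have ab: "a \<in> {..<?n} \<rightarrow>\<^sub>E carrier G" "b \<in> {..<?n} \<rightarrow>\<^sub>E carrier G"
    using gauge_transforms_ends[OF g hyph_edge_in_Pgen[OF \<upsilon>]]
    by (auto simp: a_def b_def group.inv_closed)
  have "group K" using \<open>group G\<close> by (simp add: K_def)
  have top: "topspace ?P = carrier K"
    using topspace_power_topology[OF L] by (simp add: K_def)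
  note hom = homeomorphic_maps_power_translation[OF L ab, folded K_def]
  have space: "space \<mu> = connections r emb M G"
    using sets_eq_imp_space_eq[OF \<mu>] topspace_connection_topology[OF L] by simp
  have act: "?act \<in> measurable \<mu> \<mu>"
    unfolding measurable_cong_sets[OF refl \<mu>]
    by (rule continuous_map_measurable_borel_of[OF _ \<mu>])
      (use homeomorphic_maps_gauge_act[OF L g] in \<open>simp add: homeomorphic_maps_def\<close>)
  have hp: "?hp \<in> measurable \<mu> (borel_of ?P)"
    by (rule continuous_map_measurable_borel_of[OF continuous_map_hyph_proj[OF L \<upsilon>] \<mu>])
  have T: "(\<lambda>x. a \<otimes>\<^bsub>K\<^esub> x \<otimes>\<^bsub>K\<^esub> b) \<in> measurable (borel_of ?P) (borel_of ?P)"
    using hom by (intro continuous_map_measurable_borel_of[of ?P]) (simp_all add: homeomorphic_maps_def)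
  have "distr (distr \<mu> \<mu> ?act) (borel_of ?P) ?hp = distr \<mu> (borel_of ?P) (?hp \<circ> ?act)"
    by (rule distr_distr[OF hp act])
  \<comment> \<open>Projection intertwines the action with the translation; on each edge this is the
    transformation law.\<close>
  also have "\<dots> = distr \<mu> (borel_of ?P) ((\<lambda>x. a \<otimes>\<^bsub>K\<^esub> x \<otimes>\<^bsub>K\<^esub> b) \<circ> ?hp)"
    by (intro distr_cong refl)
      (auto simp: hyph_proj_def gauge_act_path_class hyph_edge_in_Pgen[OF \<upsilon>] K_def a_def b_def
        intro!: restrict_ext)
  also have "\<dots> = distr (distr \<mu> (borel_of ?P) ?hp) (borel_of ?P) (\<lambda>x. a \<otimes>\<^bsub>K\<^esub> x \<otimes>\<^bsub>K\<^esub> b)"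
    by (rule distr_distr[OF T hp, symmetric])
  finally show "normalized_haar (product_group {..<?n} (\<lambda>_. G)) ?P
      (distr (distr \<mu> \<mu> ?act) (borel_of ?P) ?hp)"
    using normalized_haar_distr_translation[OF \<open>group K\<close> top _ _ _ hom] ab marg \<upsilon>
    by (simp add: haar_marginals_def K_def)
qed

theorem corollary7p1:
  fixes r :: regularity and emb :: bool
    and M :: "('m, 'e::real_normed_vector) mfd"
    and G :: "'g monoid" and L :: "('g, 'f::real_normed_vector) mfd"
  assumes "r \<noteq> Ck 0"
    and "is_manifold r M"
    and "lie_group G L"
    and "connected_space (mtop L)"
  shows "(\<exists>!\<Theta>. is_gauge_action r emb M G \<Theta>) \<and>
    (\<forall>\<Theta>. is_gauge_action r emb M G \<Theta> \<longrightarrow>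
       continuous_map
         (prod_topology (connection_topology r emb M G L) (gauge_topology M L))
         (connection_topology r emb M G L) \<Theta> \<and>
       (\<forall>g\<in>gauge_transforms M G.
          homeomorphic_map (connection_topology r emb M G L) (connection_topology r emb M G L)
            (\<lambda>A. \<Theta> (A, g)) \<and>
          (compact_space (mtop L) \<longrightarrow>
             (\<forall>\<mu>\<^sub>0. ashtekar_lewandowski r emb M G L \<mu>\<^sub>0 \<longrightarrow>
                (\<lambda>A. \<Theta> (A, g)) \<in> measurable \<mu>\<^sub>0 \<mu>\<^sub>0 \<and> distr \<mu>\<^sub>0 \<mu>\<^sub>0 (\<lambda>A. \<Theta> (A, g)) = \<mu>\<^sub>0)) \<and>
          homeomorphic_maps (connection_topology r emb M G L) (connection_topology r emb M G L)
            (\<lambda>A. \<Theta> (A, g)) (\<lambda>A. \<Theta> (A, gauge_inverse M G g))))"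
proof (intro conjI allI impI)
  have "group G" using assms(3) by (simp add: lie_group_def)
  note iff = is_gauge_action_iff[OF this, of r emb M]
  show "\<exists>!\<Theta>. is_gauge_action r emb M G \<Theta>"
    unfolding iff by simp
  fix \<Theta> assume "is_gauge_action r emb M G \<Theta>"
  then have \<Theta>: "\<Theta> (A, g) = gauge_act r emb M G A g"
    if "A \<in> connections r emb M G" "g \<in> gauge_transforms M G" for A g
    using that by (simp add: iff)
  let ?X = "connection_topology r emb M G L"
  note topX = topspace_connection_topology[OF assms(3), of r emb M]
  show "continuous_map (prod_topology ?X (gauge_topology M L)) ?X \<Theta>"
    using continuous_map_gauge_act[OF assms(3)]
    by (rule continuous_map_eq) (use assms(3) in \<open>auto simp: topX topspace_gauge_topology \<Theta>\<close>)
  show "\<forall>g\<in>gauge_transforms M G. homeomorphic_map ?X ?X (\<lambda>A. \<Theta> (A, g)) \<and>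
          (compact_space (mtop L) \<longrightarrow>
             (\<forall>\<mu>\<^sub>0. ashtekar_lewandowski r emb M G L \<mu>\<^sub>0 \<longrightarrow>
                (\<lambda>A. \<Theta> (A, g)) \<in> measurable \<mu>\<^sub>0 \<mu>\<^sub>0 \<and> distr \<mu>\<^sub>0 \<mu>\<^sub>0 (\<lambda>A. \<Theta> (A, g)) = \<mu>\<^sub>0)) \<and>
          homeomorphic_maps ?X ?X (\<lambda>A. \<Theta> (A, g)) (\<lambda>A. \<Theta> (A, gauge_inverse M G g))"
  proof (intro ballI conjI impI allI)
    fix g assume g: "g \<in> gauge_transforms M G"
    note act = homeomorphic_maps_gauge_act[OF assms(3) g, of r emb]
    show hom: "homeomorphic_maps ?X ?X (\<lambda>A. \<Theta> (A, g)) (\<lambda>A. \<Theta> (A, gauge_inverse M G g))"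
      using act
      by (rule homeomorphic_maps_eq)
        (simp_all add: topX \<Theta> g gauge_inverse_in_gauge_transforms[OF \<open>group G\<close>])
    then show "homeomorphic_map ?X ?X (\<lambda>A. \<Theta> (A, g))"
      by (rule homeomorphic_maps_imp_map)
    fix \<mu> assume "ashtekar_lewandowski r emb M G L \<mu>"
    \<comment> \<open>The characterization is read twice: at \<nu> = \<mu> for the properties of
      \<mu>, and at the image measure to conclude that it equals \<mu>.\<close>
    then have AL: "regular_borel ?X \<nu> \<and> haar_marginals r emb M G L \<nu> \<longleftrightarrow> \<nu> = \<mu>" for \<nu>
      by (simp add: ashtekar_lewandowski_def)
    have reg: "regular_borel ?X \<mu>" and marg: "haar_marginals r emb M G L \<mu>"
      using AL[of \<mu>] by simp_all
    have \<mu>: "sets \<mu> = sets (borel_of ?X)"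
      using reg by (simp add: regular_borel_def)
    show "(\<lambda>A. \<Theta> (A, g)) \<in> measurable \<mu> \<mu>"
      unfolding measurable_cong_sets[OF refl \<mu>]
      by (rule continuous_map_measurable_borel_of[OF _ \<mu>])
        (use hom in \<open>simp add: homeomorphic_maps_def\<close>)
    \<comment> \<open>The space of \<mu> is the set of connections, where \<Theta> is known to agree
      with \<open>gauge_act\<close>.\<close>
    have "distr \<mu> \<mu> (\<lambda>A. \<Theta> (A, g)) = distr \<mu> \<mu> (\<lambda>A. gauge_act r emb M G A g)"
      using sets_eq_imp_space_eq[OF \<mu>] by (intro distr_cong refl) (simp add: topX \<Theta> g)
    also have "\<dots> = \<mu>"
      using regular_borel_distr_homeomorphic[OF act reg \<mu>]
        haar_marginals_distr_gauge_act[OF assms(3) g \<mu> marg]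
      by (simp flip: AL)
    finally show "distr \<mu> \<mu> (\<lambda>A. \<Theta> (A, g)) = \<mu>" .
  qed
qed

end
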